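(* Let $d,N\ge 1$ be integers, let $\Sigma\in\mathbb{R}^{d\times d}$ be a symmetric positive semi-definite matrix, and let $S\subset\mathbb{R}^d$ be a symmetric set such that $\mathrm{span}(S)=\mathbb{R}^d$. Let $\delta\in(0,1/4]$ and $r^*\in\mathbb{R}$. If $\hat\mu:\mathbb{R}^{Nd}\to\mathbb{R}^d$ is an estimator (a measurable map) such that for all $\mu^*\in\mathbb{R}^d$, $$\mathbb{P}_{\mu^*}^N\left[\|\hat\mu-\mu^*\|_S\le r^*\right]\ge 1-\delta,$$ then $$r^*\ge \max\left(\frac{1}{24}\sqrt{\frac{\log 2}{\log(5/4)}}\;\frac{\ell^*(\Sigma^{1/2}S)}{\sqrt N},\ \ \frac{\sup_{v\in S}\|\Sigma^{1/2}v\|_2}{12}\sqrt{\frac{\log(1/\delta)}{N}}\right).$$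
   Context: A set $S\subset\mathbb{R}^d$ is symmetric if $x\in S$ implies $-x\in S$. For $x\in\mathbb{R}^d$, $\|x\|_S=\sup_{v\in S}\langle v,x\rangle$. $\mathbb{P}_{\mu^*}^N$ denotes the law of $(X_1,\dots,X_N)$ where $X_1,\dots,X_N$ are i.i.d. $\mathcal{N}(\mu^*,\Sigma)$ in $\mathbb{R}^d$; under it, $\hat\mu$ stands for $\hat\mu(X_1,\dots,X_N)$. The Gaussian mean width is $\ell^*(\Sigma^{1/2}S)=\mathbb{E}\sup_{x\in\Sigma^{1/2}S}\langle G,x\rangle=\mathbb{E}\|\Sigma^{1/2}G\|_S$ with $G\sim\mathcal{N}(0,I_d)$. $\|\cdot\|_2$ is the Euclidean norm. *)

theory Defs
  imports "HOL-Probability.Probability"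
begin

definition symmetric_set :: "'a::real_vector set \<Rightarrow> bool" where
  "symmetric_set S \<longleftrightarrow> (\<forall>x\<in>S. - x \<in> S)"

text \<open>The supremum is taken in the extended reals, so that an unbounded \<open>S\<close> is
  allowed and the value may be \<open>\<infinity>\<close>.\<close>

definition sup_norm_on :: "'a::real_inner set \<Rightarrow> 'a \<Rightarrow> ereal" where
  "sup_norm_on S x = (SUP v\<in>S. ereal (v \<bullet> x))"

definition psd_matrix :: "real^'d^'d \<Rightarrow> bool" where
  "psd_matrix A \<longleftrightarrow> transpose A = A \<and> (\<forall>x. 0 \<le> x \<bullet> (A *v x))"

text \<open>Meaningful for positive semi-definite \<open>A\<close>, where the positive semi-definite
  square root exists and is unique.\<close>

definition psd_sqrt :: "real^'d^'d \<Rightarrow> real^'d^'d" where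
  "psd_sqrt A = (THE B. psd_matrix B \<and> B ** B = A)"

definition std_gaussian :: "(real^'d) measure" where
  "std_gaussian = density lborel (\<lambda>x. ennreal (\<Prod>i\<in>UNIV. std_normal_density (x $ i)))"

text \<open>Defined as an affine image of the standard Gaussian, because a singular
  covariance matrix admits no Lebesgue density.\<close>

definition gaussian :: "real^'d \<Rightarrow> real^'d^'d \<Rightarrow> (real^'d) measure" where
  "gaussian \<mu> \<Sigma> = distr std_gaussian borel (\<lambda>g. \<mu> + psd_sqrt \<Sigma> *v g)"

text \<open>Samples \<open>(X\<^sub>1, \<dots>, X\<^sub>N)\<close> are functions on the index set \<open>{..<N}\<close>.\<close>

definition gaussian_sample :: "nat \<Rightarrow> real^'d \<Rightarrow> real^'d^'d \<Rightarrow> (nat \<Rightarrow> real^'d) measure" where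
  "gaussian_sample N \<mu> \<Sigma> = PiM {..<N} (\<lambda>_. gaussian \<mu> \<Sigma>)"

text \<open>The expectation is a nonnegative integral with values in \<open>[0, \<infinity>]\<close>. For nonempty
  symmetric \<open>T\<close> the integrand is nonnegative, hence \<open>e2ennreal\<close> does not truncate it.\<close>

definition gaussian_mean_width :: "(real^'d) set \<Rightarrow> ereal" where
  "gaussian_mean_width T =
     enn2ereal (\<integral>\<^sup>+ g. e2ennreal (SUP x\<in>T. ereal (g \<bullet> x)) \<partial>std_gaussian)"

end

theory Submission
  imports Defs
begin

text \<open>
  Write \<open>A\<close> for the square root of \<open>\<Sigma>\<close>. Only means of the form \<open>A h\<close> are used: there the
  sample is the linear image, under \<open>A\<close>, of noise with mean \<open>h\<close> and identity covariance, and the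
  law of such noise has the explicit likelihood \<open>exp (h \<bullet> (x\<^sub>1 + \<dots> + x\<^sub>N) - N (h \<bullet> h) / 2)\<close> with
  respect to centred noise (\<open>gaussian_sample_eq\<close>). So a possibly singular covariance causes no
  difficulty, and both lower bounds become statements about this likelihood.

  The mean width term is a Bayesian bound. Put the prior \<open>N(0, (4/N) I)\<close> on \<open>h\<close>. Completing the
  square shows that the posterior of \<open>h\<close> is Gaussian with covariance \<open>I / (5N/4)\<close>, whatever the
  data (\<open>bayes_gaussian_prior\<close>). Coverage holds for every \<open>h\<close>, hence on average over the prior, so
  some data set has posterior coverage at least \<open>3/4\<close> (\<open>posterior_coverage\<close>): there is a point \<open>a\<close>
  such that \<open>a - A G\<close> has seminorm at most \<open>\<rho> = r sqrt(5N/4)\<close> with probability at least \<open>3/4\<close>. Since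
  \<open>G\<close> and \<open>-G\<close> have the same law, the centre \<open>a\<close> costs only a factor two (\<open>coverage_centering\<close>),
  which replaces Anderson's inequality. Finally, the mean of a seminorm of a Gaussian vector is
  at most \<open>11/2\<close> times any \<open>3/4\<close>-quantile (\<open>gaussian_mean_le_quantile\<close>); this is Fernique's rotation
  argument, applied to means instead of tails. Together the width is at most
  \<open>11 r sqrt(5N/4)\<close>, and \<open>11 sqrt(5/4)\<close> is below the reciprocal of the constant in the
  statement.

  The deviation term is a two-point bound. For \<open>v \<in> S\<close>, compare the mean \<open>0\<close> with a mean \<open>A h\<close>,
  where \<open>h\<close> points along \<open>A v\<close> and \<open>v \<bullet> A h > 2 r\<close>. A single event then has probability at most \<open>\<delta>\<close>
  under the first law and at least \<open>1 - \<delta>\<close> under the second, while the second moment of the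
  likelihood is only \<open>exp (N (h \<bullet> h))\<close> (\<open>change_of_measure\<close>); this is contradictory when
  \<open>r\<close> is below the claimed bound.
\<close>

section \<open>Positive semi-definite square roots\<close>

lemma psd_matrix_symD: "psd_matrix A \<Longrightarrow> (A *v x) \<bullet> y = x \<bullet> (A *v y)"
  by (metis dot_lmul_matrix psd_matrix_def transpose_matrix_vector)

text \<open>If \<open>x\<close> is isotropic for the quadratic form, then moving slightly from \<open>x\<close> against \<open>A x\<close> would make
  the form negative, unless \<open>A x = 0\<close>.\<close>

lemma psd_matrix_null:
  assumes A: "psd_matrix A" and x: "x \<bullet> (A *v x) = 0"
  shows "A *v x = 0"
proof -
  define y where "y = A *v x"
  define q where "q = y \<bullet> (A *v y)"
  have q0: "q \<ge> 0" using A by (auto simp: q_def psd_matrix_def)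
  \<comment> \<open>The step size; \<open>q + 1\<close> instead of \<open>q\<close> avoids a division by zero.\<close>
  define e where "e = (y \<bullet> y) / (q + 1)"
  have sym: "y \<bullet> (A *v x) = x \<bullet> (A *v y)" "x \<bullet> (A *v y) = y \<bullet> y"
    using psd_matrix_symD[OF A] by (metis inner_commute, metis y_def)
  have "0 \<le> (x - e *\<^sub>R y) \<bullet> (A *v (x - e *\<^sub>R y))"
    using A by (auto simp: psd_matrix_def)
  also have "\<dots> = - 2 * e * (y \<bullet> y) + e * e * q"
    using x sym by (simp add: matrix_vector_mult_diff_distrib matrix_vector_mult_scaleR
      inner_diff_left inner_diff_right q_def algebra_simps)
  finally have *: "2 * e * (y \<bullet> y) \<le> e * e * q" by simp
  have e: "e * (q + 1) = y \<bullet> y" "e \<ge> 0" using q0 by (auto simp: e_def)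
  have "2 * e * (e * (q + 1)) \<le> e * e * q" using * by (simp only: e(1))
  hence "e * e * (q + 2) \<le> 0" by (simp add: algebra_simps)
  moreover have "e * e * (q+2) \<ge> 0" using q0 by simp
  ultimately have "e = 0" using q0 by (auto simp: mult_le_0_iff)
  thus ?thesis using e(1) by (simp add: y_def)
qed

lemma trace_congruence:
  fixes B D :: "real^'d^'d"
  assumes "transpose D = D"
  shows "trace (D ** B ** D) = (\<Sum>i\<in>UNIV. (D *v axis i 1) \<bullet> (B *v (D *v axis i 1)))"
proof -
  have "(D ** B ** D) $ i $ i = (D *v axis i 1) \<bullet> (B *v (D *v axis i 1))" for i
  proof -
    have "(D ** B ** D) $ i $ i = axis i 1 \<bullet> ((D ** B ** D) *v axis i 1)"
      by (simp add: inner_axis' matrix_vector_mul_component inner_axis)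
    also have "\<dots> = axis i 1 \<bullet> (D *v (B *v (D *v axis i 1)))"
      by (simp add: matrix_vector_mul_assoc matrix_mul_assoc)
    also have "\<dots> = (D *v axis i 1) \<bullet> (B *v (D *v axis i 1))"
      by (metis assms dot_lmul_matrix transpose_matrix_vector)
    finally show ?thesis .
  qed
  thus ?thesis by (simp add: trace_def)
qed

lemma matrix_diff_distrib:
  fixes A B :: "real^'n^'m" and C :: "real^'k^'n" and D :: "real^'m^'l"
  shows "(A - B) ** C = A ** C - B ** C" "D ** (A - B) = D ** A - D ** B"
  by (simp_all add: matrix_matrix_mult_def vec_eq_iff sum_subtractf algebra_simps)

text \<open>With \<open>D = B - C\<close>, the hypothesis reads \<open>B D + D C = 0\<close>. Multiplying by \<open>D\<close> and taking traces gives
  \<open>tr (D B D) + tr (D C D) = 0\<close>, a sum of nonnegative diagonal entries. Hence \<open>B\<close> and \<open>C\<close> both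
  vanish on the range of \<open>D\<close>, so \<open>D D = 0\<close> and \<open>D = 0\<close>.\<close>

lemma psd_sqrt_unique:
  assumes B: "psd_matrix (B :: real^'d^'d)" and C: "psd_matrix C" and eq: "B ** B = C ** C"
  shows "B = C"
proof -
  define D where "D = B - C"
  have symD: "transpose D = D"
    using B C by (simp add: D_def psd_matrix_def transpose_def vec_eq_iff)
  have "D ** B ** D + D ** D ** C = D ** (B ** B - C ** C)"
    by (simp add: D_def matrix_diff_distrib matrix_mul_assoc)
  also have "\<dots> = 0" unfolding eq diff_self by (simp add: matrix_matrix_mult_def vec_eq_iff)
  finally have "trace (D ** B ** D + D ** D ** C) = 0" by (simp add: trace_def)
  hence "trace (D ** B ** D) + trace (D ** D ** C) = 0"
    by (simp only: trace_add)
  moreover have "trace (D ** D ** C) = trace (D ** C ** D)"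
    using trace_mul_sym[of D "D ** C"] by (simp only: matrix_mul_assoc)
  ultimately have s: "(\<Sum>i\<in>UNIV. (D *v axis i 1) \<bullet> (B *v (D *v axis i 1))
      + (D *v axis i 1) \<bullet> (C *v (D *v axis i 1))) = 0"
    by (simp add: trace_congruence[OF symD] sum.distrib)
  have nB: "0 \<le> x \<bullet> (B *v x)" and nC: "0 \<le> x \<bullet> (C *v x)" for x
    using B C by (auto simp: psd_matrix_def)
  have De: "D *v axis i 1 = 0" for i
  proof -
    let ?d = "D *v axis i 1"
    have "\<forall>i\<in>UNIV. (D *v axis i 1) \<bullet> (B *v (D *v axis i 1))
      + (D *v axis i 1) \<bullet> (C *v (D *v axis i 1)) = 0"
      by (rule iffD1[OF sum_nonneg_eq_0_iff s]) (simp_all add: nB nC)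
    hence "?d \<bullet> (B *v ?d) + ?d \<bullet> (C *v ?d) = 0" by blast
    hence "?d \<bullet> (B *v ?d) = 0" "?d \<bullet> (C *v ?d) = 0"
      using nB[of ?d] nC[of ?d] by linarith+
    hence "B *v ?d = 0" "C *v ?d = 0"
      using psd_matrix_null B C by blast+
    hence "D *v ?d = 0" by (simp add: D_def matrix_vector_mult_diff_rdistrib)
    moreover have "?d \<bullet> ?d = axis i 1 \<bullet> (D *v ?d)"
      using dot_lmul_matrix[of "axis i 1" D ?d] transpose_matrix_vector[of D "axis i 1"] by (simp only: symD)
    ultimately have "?d \<bullet> ?d = 0" by simp
    thus ?thesis by simp
  qed
  have "column i D = 0" for i using De[of i] by (simp only: matrix_vector_mult_basis)
  hence "D = 0" by (simp add: vec_eq_iff column_def)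
  thus ?thesis by (simp add: D_def)
qed

text \<open>Evaluating the quadratic form of \<open>Y\<close> at \<open>x - Y x\<close> gives \<open>Y x \<bullet> Y x \<le> x \<bullet> Y x\<close>.\<close>

lemma contraction_of_psd_le_id:
  assumes Y: "transpose Y = (Y::real^'d^'d)" and le: "\<And>x. 0 \<le> x \<bullet> (Y *v x) \<and> x \<bullet> (Y *v x) \<le> x \<bullet> x"
  shows "(Y *v x) \<bullet> (Y *v x) \<le> x \<bullet> x"
proof -
  have psd: "psd_matrix Y" using assms by (auto simp: psd_matrix_def)
  define y where "y = Y *v x"
  have sym: "y \<bullet> (Y *v x) = y \<bullet> y" "x \<bullet> (Y *v y) = y \<bullet> y"
    using psd_matrix_symD[OF psd] by (auto simp: y_def)
  have "0 \<le> (x - y) \<bullet> (Y *v (x - y))" using le by blast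
  also have "\<dots> = x \<bullet> (Y *v x) - 2 * (y \<bullet> y) + y \<bullet> (Y *v y)"
    using sym by (simp add: matrix_vector_mult_diff_distrib inner_diff_left inner_diff_right)
  finally show ?thesis using le[of y] le[of x] by (simp add: y_def)
qed

text \<open>A square root \<open>B = 1 - Y\<close> of \<open>M\<close> is the same as a solution of \<open>Y = (1 - M + Y Y) / 2\<close>. When
  \<open>0 \<le> M \<le> 1\<close>, the right-hand side maps the compact convex set of symmetric matrices
  \<open>0 \<le> Y \<le> 1\<close> into itself, so Brouwer's theorem provides \<open>Y\<close>.\<close>

lemma psd_sqrt_exists_le_id:
  assumes M: "psd_matrix (M::real^'d^'d)" and le: "\<And>x. x \<bullet> (M *v x) \<le> x \<bullet> x"
  shows "\<exists>B. psd_matrix B \<and> B ** B = M"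
proof -
  define X where "X = mat 1 - M"
  define K where "K = {Y::real^'d^'d. transpose Y = Y \<and> (\<forall>x. 0 \<le> x \<bullet> (Y *v x) \<and> x \<bullet> (Y *v x) \<le> x \<bullet> x)}"
  define f where "f Y = (1/2) *\<^sub>R (X + Y ** Y)" for Y :: "real^'d^'d"
  have Xq: "x \<bullet> (X *v x) = x \<bullet> x - x \<bullet> (M *v x)" for x
    by (simp add: X_def matrix_vector_mult_diff_rdistrib inner_diff_right)
  have Xs: "transpose X = X"
    using M by (simp add: X_def psd_matrix_def transpose_def vec_eq_iff mat_def)
  have K0: "mat 0 \<in> K" by (simp add: K_def transpose_def vec_eq_iff)
  have q: "x \<bullet> ((a *\<^sub>R Y + b *\<^sub>R Z) *v x) = a * (x \<bullet> (Y *v x)) + b * (x \<bullet> (Z *v x))"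
    for x and a b :: real and Y Z :: "real^'d^'d"
    by (simp add: matrix_vector_mult_add_rdistrib inner_add_right scaleR_matrix_vector_assoc[symmetric])
  have "convex K"
  proof (rule convexI)
    fix Y Z and u v :: real assume YZ: "Y \<in> K" "Z \<in> K" and uv: "0 \<le> u" "0 \<le> v" "u + v = 1"
    have "transpose (u *\<^sub>R Y + v *\<^sub>R Z) = u *\<^sub>R Y + v *\<^sub>R Z"
      using YZ by (simp add: K_def transpose_def vec_eq_iff)
    moreover have "0 \<le> x \<bullet> ((u *\<^sub>R Y + v *\<^sub>R Z) *v x)" for x
      using YZ uv by (simp add: K_def q)
    moreover have "x \<bullet> ((u *\<^sub>R Y + v *\<^sub>R Z) *v x) \<le> x \<bullet> x" for x
      using YZ uv unfolding q by (intro convex_bound_le) (auto simp: K_def)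
    ultimately show "u *\<^sub>R Y + v *\<^sub>R Z \<in> K" by (simp add: K_def)
  qed
  moreover have "compact K"
  proof -
    have "closed K"
    proof -
      have c: "continuous_on UNIV (\<lambda>Y::real^'d^'d. x \<bullet> (Y *v x))" for x
        unfolding matrix_vector_mult_def by (intro continuous_intros)
      have t: "continuous_on UNIV (\<lambda>Y::real^'d^'d. transpose Y)"
        unfolding transpose_def by (intro continuous_intros)
      show ?thesis unfolding K_def
        by (intro closed_Collect_conj closed_Collect_all closed_Collect_eq closed_Collect_le c t
            continuous_intros)
    qed
    moreover have "bounded K"
    proof -
      have "norm Y \<le> real CARD('d)" if "Y \<in> K" for Y
      proof -
        have r: "norm (Y $ i) \<le> 1" for i
        proof -
          have "Y $ i = Y *v axis i 1"
            using that by (simp add: K_def matrix_vector_mult_basis column_def transpose_def vec_eq_iff)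
          moreover have "(Y *v axis i 1) \<bullet> (Y *v axis i 1) \<le> axis i 1 \<bullet> axis i (1::real)"
            using that by (intro contraction_of_psd_le_id) (auto simp: K_def)
          ultimately show ?thesis by (simp add: norm_eq_sqrt_inner inner_axis_axis)
        qed
        have "norm Y \<le> (\<Sum>i\<in>UNIV. norm (Y $ i))" unfolding norm_vec_def
          by (rule L2_set_le_sum) auto
        also have "\<dots> \<le> (\<Sum>i\<in>(UNIV::'d set). 1)" by (intro sum_mono r)
        finally show ?thesis by simp
      qed
      thus ?thesis by (auto simp: bounded_iff)
    qed
    ultimately show ?thesis by (simp add: compact_eq_bounded_closed)
  qed
  moreover have "continuous_on K f"
    unfolding f_def matrix_matrix_mult_def by (intro continuous_intros)
  moreover have "f \<in> K \<rightarrow> K"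
  proof
    fix Y assume Y: "Y \<in> K"
    hence s: "transpose Y = Y" by (simp add: K_def)
    have qq: "x \<bullet> (f Y *v x) = (1/2) * (x \<bullet> (X *v x)) + (1/2) * ((Y *v x) \<bullet> (Y *v x))" for x
    proof -
      have "(Y *v x) \<bullet> (Y *v x) = x \<bullet> ((Y ** Y) *v x)"
        by (metis dot_lmul_matrix matrix_vector_mul_assoc s transpose_matrix_vector)
      thus ?thesis by (simp only: f_def scaleR_add_right q)
    qed
    have c: "(Y *v x) \<bullet> (Y *v x) \<le> x \<bullet> x" for x
      using Y by (intro contraction_of_psd_le_id) (auto simp: K_def)
    have "transpose (Y ** Y) = Y ** Y" by (simp add: matrix_transpose_mul s)
    hence "transpose (f Y) = f Y" using Xs by (simp add: f_def transpose_def vec_eq_iff)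
    moreover have "0 \<le> x \<bullet> (f Y *v x)" for x
      using le[of x] by (simp add: qq Xq)
    moreover have "x \<bullet> (f Y *v x) \<le> x \<bullet> x" for x
    proof -
      have "0 \<le> x \<bullet> (M *v x)" using M by (simp add: psd_matrix_def)
      thus ?thesis using c[of x] unfolding qq Xq by argo
    qed
    ultimately show "f Y \<in> K" by (simp add: K_def)
  qed
  ultimately obtain Y where Y: "Y \<in> K" "f Y = Y"
    using brouwer[of K f] K0 by blast
  have "X + Y ** Y = 2 *\<^sub>R f Y" by (simp add: f_def)
  hence "X + Y ** Y = 2 *\<^sub>R Y" by (simp only: Y(2))
  hence "2 *\<^sub>R Y - Y ** Y = X" by (metis add_diff_cancel_right')
  hence "M = mat 1 - (2 *\<^sub>R Y - Y ** Y)" by (simp add: X_def)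
  also have "\<dots> = mat 1 - Y - (Y - Y ** Y)" by (simp add: vec_eq_iff)
  also have "\<dots> = (mat 1 - Y) ** (mat 1 - Y)" by (simp only: matrix_diff_distrib matrix_mul_lid matrix_mul_rid)
  finally have "(mat 1 - Y) ** (mat 1 - Y) = M" ..
  moreover have "psd_matrix (mat 1 - Y)"
  proof -
    have "transpose (mat 1 - Y) = mat 1 - Y"
      using Y(1) by (simp add: K_def transpose_def vec_eq_iff mat_def)
    thus ?thesis using Y(1)
      by (simp add: K_def psd_matrix_def matrix_vector_mult_diff_rdistrib inner_diff_right)
  qed
  ultimately show ?thesis by blast
qed

lemma psd_sqrt_exists:
  assumes M: "psd_matrix (M::real^'d^'d)"
  shows "\<exists>B. psd_matrix B \<and> B ** B = M"
proof -
  obtain c where c: "c > 0" "\<And>x. norm (M *v x) \<le> norm x * c"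
    using bounded_linear.pos_bounded[OF matrix_vector_mul_bounded_linear[of M]] by blast
  have b: "x \<bullet> (M *v x) \<le> c * (x \<bullet> x)" for x
  proof -
    have "x \<bullet> (M *v x) \<le> norm x * norm (M *v x)" by (rule norm_cauchy_schwarz)
    also have "\<dots> \<le> norm x * (norm x * c)" by (intro mult_left_mono c) auto
    finally show ?thesis by (simp add: dot_square_norm power2_eq_square mult_ac)
  qed
  have q: "x \<bullet> (((1/c) *\<^sub>R M) *v x) = (1/c) * (x \<bullet> (M *v x))" for x
    by (simp add: scaleR_matrix_vector_assoc[symmetric])
  have "psd_matrix ((1/c) *\<^sub>R M)" unfolding psd_matrix_def q
    using M c by (auto simp: psd_matrix_def transpose_def vec_eq_iff)
  moreover have "x \<bullet> (((1/c) *\<^sub>R M) *v x) \<le> x \<bullet> x" for x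
    unfolding q using b[of x] c by (simp add: divide_le_eq mult.commute)
  ultimately obtain B where B: "psd_matrix B" "B ** B = (1/c) *\<^sub>R M"
    using psd_sqrt_exists_le_id by blast
  have "(sqrt c *\<^sub>R B) ** (sqrt c *\<^sub>R B) = M"
  proof -
    have "(s *\<^sub>R B) ** (s *\<^sub>R B) = (s * s) *\<^sub>R (B ** B)" for s :: real
      by (simp add: matrix_matrix_mult_def vec_eq_iff sum_distrib_left mult_ac)
    from this[of "sqrt c"] show ?thesis using B(2) c by simp
  qed
  moreover have "psd_matrix (sqrt c *\<^sub>R B)" using B(1) c
    by (auto simp: psd_matrix_def transpose_def vec_eq_iff scaleR_matrix_vector_assoc[symmetric])
  ultimately show ?thesis by blast
qed

text \<open>Existence and uniqueness make the definite description in \<open>psd_sqrt\<close> meaningful. The symmetry of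
  the root, which follows, is what allows \<open>A\<close> to be moved across inner products later on.\<close>

lemma psd_matrix_psd_sqrt:
  assumes "psd_matrix \<Sigma>"
  shows "psd_matrix (psd_sqrt \<Sigma>)"
proof -
  have "\<exists>!B. psd_matrix B \<and> B ** B = \<Sigma>"
    using psd_sqrt_exists[OF assms] psd_sqrt_unique by blast
  from theI'[OF this] show ?thesis by (simp add: psd_sqrt_def)
qed

section \<open>The standard Gaussian measure\<close>

definition gauss_density :: "real^'d \<Rightarrow> real" where
  "gauss_density x = (1 / sqrt (2 * pi)) ^ CARD('d) * exp (- (x \<bullet> x) / 2)"

lemma measurable_gauss_density [measurable]: "gauss_density \<in> borel_measurable borel"
  unfolding gauss_density_def by measurable

lemma gauss_density_nonneg: "0 \<le> gauss_density x"
  by (simp add: gauss_density_def)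

lemma std_gaussian_eq: "std_gaussian = density lborel (\<lambda>x::real^'d. ennreal (gauss_density x))"
proof -
  have "(\<Prod>i\<in>UNIV. std_normal_density (x $ i)) = gauss_density x" for x :: "real^'d"
    unfolding std_normal_density_def gauss_density_def
    by (simp add: prod.distrib exp_sum[symmetric] inner_vec_def power2_eq_square
      sum_negf[symmetric] sum_divide_distrib prod_dividef power_one_over)
  thus ?thesis by (simp add: std_gaussian_def)
qed

lemma sets_std_gaussian [measurable_cong, simp]: "sets std_gaussian = sets borel"
  and space_std_gaussian [simp]: "space std_gaussian = UNIV"
  by (auto simp: std_gaussian_def)

lemma prob_space_std_gaussian: "prob_space (std_gaussian :: (real^'d) measure)"
proof
  let ?n = "\<lambda>t. ennreal (std_normal_density t)"
  have eq: "ennreal (\<Prod>i\<in>UNIV. std_normal_density (x $ i)) = (\<Prod>b\<in>Basis. ?n (x \<bullet> b))" for x :: "real^'d"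
  proof -
    have B: "(Basis :: (real^'d) set) = (\<lambda>i. axis i 1) ` UNIV"
      by (auto simp: Basis_vec_def)
    have "(\<Prod>b\<in>Basis. ?n (x \<bullet> b)) = (\<Prod>i\<in>UNIV. ?n (x $ i))"
      unfolding B by (subst prod.reindex) (auto simp: inj_on_def axis_eq_axis inner_axis)
    thus ?thesis by (simp add: prod_ennreal)
  qed
  have "emeasure std_gaussian (space (std_gaussian::(real^'d) measure))
      = (\<integral>\<^sup>+x. (\<Prod>b\<in>Basis. ?n ((x::real^'d) \<bullet> b)) \<partial>lborel)"
    unfolding std_gaussian_def by (simp add: emeasure_density eq)
  also have "\<dots> = (\<Prod>b\<in>(Basis::(real^'d) set). (\<integral>\<^sup>+t. ?n t \<partial>lborel))"
    by (rule nn_integral_lborel_prod) auto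
  also have "(\<integral>\<^sup>+t. ?n t \<partial>lborel) = 1"
    using prob_space.emeasure_space_1[OF prob_space_normal_density[of 1 0]]
    by (simp add: emeasure_density)
  finally show "emeasure std_gaussian (space (std_gaussian::(real^'d) measure)) = 1" by simp
qed

lemma nn_integral_std_gaussian:
  assumes [measurable]: "f \<in> borel_measurable borel"
  shows "(\<integral>\<^sup>+x. f x \<partial>std_gaussian) = (\<integral>\<^sup>+x. ennreal (gauss_density x) * f x \<partial>lborel)"
  unfolding std_gaussian_eq by (subst nn_integral_density) auto

lemma nn_integral_lborel_affine:
  fixes f :: "'a::euclidean_space \<Rightarrow> ennreal"
  assumes [measurable]: "f \<in> borel_measurable borel" and c: "c \<noteq> 0"
  shows "(\<integral>\<^sup>+x. f x \<partial>lborel) = ennreal (\<bar>c\<bar> ^ DIM('a)) * (\<integral>\<^sup>+x. f (t + c *\<^sub>R x) \<partial>lborel)"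
  by (subst lborel_affine[OF c, of t])
     (simp add: nn_integral_density nn_integral_distr nn_integral_cmult ennreal_power)

lemma gauss_density_add:
  "gauss_density (x + y) = gauss_density x * exp (- (x \<bullet> y) - (y \<bullet> y) / 2)"
  by (simp add: gauss_density_def inner_add inner_commute exp_add[symmetric] field_simps)

text \<open>The Cameron--Martin formula in finite dimension.\<close>

lemma std_gaussian_shift:
  fixes h :: "real^'d"
  assumes [measurable]: "f \<in> borel_measurable borel"
  shows "(\<integral>\<^sup>+g. f (h + g) \<partial>std_gaussian)
       = (\<integral>\<^sup>+g. ennreal (exp (h \<bullet> g - (h \<bullet> h) / 2)) * f g \<partial>std_gaussian)"
proof -
  have "(\<integral>\<^sup>+g. ennreal (exp (h \<bullet> g - (h \<bullet> h) / 2)) * f g \<partial>std_gaussian)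
     = (\<integral>\<^sup>+g. ennreal (gauss_density g) * (ennreal (exp (h \<bullet> g - (h \<bullet> h) / 2)) * f g) \<partial>lborel)"
    by (rule nn_integral_std_gaussian) measurable
  also have "\<dots> = (\<integral>\<^sup>+g. ennreal (gauss_density (h + g))
       * (ennreal (exp (h \<bullet> (h + g) - (h \<bullet> h) / 2)) * f (h + g)) \<partial>lborel)"
    by (subst nn_integral_lborel_affine[where c = 1 and t = h]) auto
  also have "\<dots> = (\<integral>\<^sup>+g. ennreal (gauss_density g) * f (h + g) \<partial>lborel)"
  proof (rule nn_integral_cong)
    fix g
    have "gauss_density (h + g) * exp (h \<bullet> (h + g) - (h \<bullet> h) / 2) = gauss_density g"
      by (simp add: add.commute[of h g] gauss_density_add inner_add inner_commute
          mult.assoc exp_add[symmetric])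
    thus "ennreal (gauss_density (h + g)) * (ennreal (exp (h \<bullet> (h + g) - (h \<bullet> h) / 2)) * f (h + g))
        = ennreal (gauss_density g) * f (h + g)"
      by (simp add: mult.assoc[symmetric] ennreal_mult'[symmetric] gauss_density_nonneg)
  qed
  also have "\<dots> = (\<integral>\<^sup>+g. f (h + g) \<partial>std_gaussian)"
    by (rule nn_integral_std_gaussian[symmetric]) measurable
  finally show ?thesis ..
qed

text \<open>Completing the square: the exponential weight turns the density \<open>exp (- (g \<bullet> g) / 2)\<close> into one
  proportional to that of a Gaussian with mean \<open>u / c\<^sup>2\<close> and covariance \<open>I / c\<^sup>2\<close>. For a posterior
  distribution, \<open>u\<close> carries the data and \<open>c\<^sup>2\<close> is the gain in precision.\<close>

lemma std_gaussian_tilt: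
  fixes u :: "real^'d"
  assumes [measurable]: "f \<in> borel_measurable borel" and c: "c > 0"
  shows "(\<integral>\<^sup>+g. ennreal (exp (u \<bullet> g - (c\<^sup>2 - 1) * (g \<bullet> g) / 2)) * f g \<partial>std_gaussian)
       = ennreal ((1 / c) ^ CARD('d) * exp ((u \<bullet> u) / (2 * c\<^sup>2)))
         * (\<integral>\<^sup>+y. f ((1 / c) *\<^sub>R (y + (1 / c) *\<^sub>R u)) \<partial>std_gaussian)"
proof -
  let ?T = "\<lambda>y. (1 / c) *\<^sub>R (y + (1 / c) *\<^sub>R u)"
  let ?E = "\<lambda>g. exp (u \<bullet> g - (c\<^sup>2 - 1) * (g \<bullet> g) / 2)"
  have T: "(1 / c\<^sup>2) *\<^sub>R u + (1 / c) *\<^sub>R y = ?T y" for y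
    by (simp add: scaleR_add_right power2_eq_square)
  have "(\<integral>\<^sup>+g. ennreal (?E g) * f g \<partial>std_gaussian)
     = (\<integral>\<^sup>+g. ennreal (gauss_density g) * (ennreal (?E g) * f g) \<partial>lborel)"
    by (rule nn_integral_std_gaussian) measurable
  also have "\<dots> = ennreal ((1 / c) ^ CARD('d)) * (\<integral>\<^sup>+y. ennreal (gauss_density (?T y))
       * (ennreal (?E (?T y)) * f (?T y)) \<partial>lborel)"
    using c by (subst nn_integral_lborel_affine[where c = "1 / c" and t = "(1 / c\<^sup>2) *\<^sub>R u"])
      (auto simp: T)
  also have "\<dots> = ennreal ((1 / c) ^ CARD('d)) * (\<integral>\<^sup>+y. ennreal (exp ((u \<bullet> u) / (2 * c\<^sup>2)))
       * (ennreal (gauss_density y) * f (?T y)) \<partial>lborel)"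
  proof (intro arg_cong[where f = "\<lambda>x. _ * x"] nn_integral_cong)
    fix y
    have "- (?T y \<bullet> ?T y) / 2 + (u \<bullet> ?T y - (c\<^sup>2 - 1) * (?T y \<bullet> ?T y) / 2)
        = (u \<bullet> u) / (2 * c\<^sup>2) + - (y \<bullet> y) / 2"
      using c by (simp add: inner_add inner_commute field_simps power2_eq_square)
    hence "gauss_density (?T y) * ?E (?T y) = exp ((u \<bullet> u) / (2 * c\<^sup>2)) * gauss_density y"
      unfolding gauss_density_def mult.assoc exp_add[symmetric] mult.left_commute[of "exp _"]
      by simp
    thus "ennreal (gauss_density (?T y)) * (ennreal (?E (?T y)) * f (?T y))
        = ennreal (exp ((u \<bullet> u) / (2 * c\<^sup>2))) * (ennreal (gauss_density y) * f (?T y))"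
      by (simp add: mult.assoc[symmetric] ennreal_mult'[symmetric] gauss_density_nonneg)
  qed
  also have "\<dots> = ennreal ((1 / c) ^ CARD('d)) * (ennreal (exp ((u \<bullet> u) / (2 * c\<^sup>2)))
       * (\<integral>\<^sup>+y. ennreal (gauss_density y) * f (?T y) \<partial>lborel))"
    by (subst nn_integral_cmult) auto
  also have "(\<integral>\<^sup>+y. ennreal (gauss_density y) * f (?T y) \<partial>lborel) = (\<integral>\<^sup>+y. f (?T y) \<partial>std_gaussian)"
    by (rule nn_integral_std_gaussian[symmetric]) measurable
  finally show ?thesis using c by (simp add: mult.assoc ennreal_mult')
qed

lemma std_gaussian_uminus:
  assumes [measurable]: "f \<in> borel_measurable borel"
  shows "(\<integral>\<^sup>+g. f (- g) \<partial>std_gaussian) = (\<integral>\<^sup>+g. f g \<partial>(std_gaussian :: (real^'d) measure))"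
proof -
  have "(\<integral>\<^sup>+g. f g \<partial>(std_gaussian :: (real^'d) measure))
      = (\<integral>\<^sup>+g. ennreal (gauss_density g) * f g \<partial>lborel)"
    by (rule nn_integral_std_gaussian) measurable
  also have "\<dots> = (\<integral>\<^sup>+g. ennreal (gauss_density (-g)) * f (-g) \<partial>lborel)"
    by (subst nn_integral_lborel_affine[where c = "-1" and t = 0]) auto
  also have "\<dots> = (\<integral>\<^sup>+g. ennreal (gauss_density g) * f (-g) \<partial>lborel)"
    by (simp add: gauss_density_def)
  also have "\<dots> = (\<integral>\<^sup>+g. f (- g) \<partial>std_gaussian)"
    by (rule nn_integral_std_gaussian[symmetric]) measurable
  finally show ?thesis ..
qed

text \<open>The density of a pair of independent standard Gaussians depends only on \<open>x \<bullet> x + y \<bullet> y\<close>, which the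
  rotation by 45 degrees preserves. The rotation is realised by two affine substitutions in one
  variable each, whose Jacobian factors cancel.\<close>

lemma std_gaussian_rotation:
  fixes f :: "(real^'d) \<times> (real^'d) \<Rightarrow> ennreal"
  assumes f [measurable]: "f \<in> borel_measurable (borel \<Otimes>\<^sub>M borel)"
  shows "(\<integral>\<^sup>+x. \<integral>\<^sup>+y. f ((1 / sqrt 2) *\<^sub>R (x + y), (1 / sqrt 2) *\<^sub>R (x - y)) \<partial>std_gaussian \<partial>std_gaussian)
       = (\<integral>\<^sup>+x. \<integral>\<^sup>+y. f (x, y) \<partial>std_gaussian \<partial>std_gaussian)"
proof -
  define a where "a = 1 / sqrt (2::real)"
  define p where "p x = ennreal (gauss_density x)" for x :: "real^'d"
  have [measurable]: "p \<in> borel_measurable borel" unfolding p_def by measurable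
  interpret G: prob_space "std_gaussian :: (real^'d) measure" by (rule prob_space_std_gaussian)
  have a: "a > 0" "a * sqrt 2 = 1" by (auto simp: a_def)
  have "sqrt 2 = 2 * a" by (simp add: a_def field_simps)
  hence id: "- (a *\<^sub>R (x + y)) + sqrt 2 *\<^sub>R x = a *\<^sub>R (x - y)" for x y :: "real^'d"
    by (simp add: algebra_simps scaleR_2[symmetric])
  have iter: "(\<integral>\<^sup>+x. \<integral>\<^sup>+y. F (x, y) \<partial>std_gaussian \<partial>std_gaussian)
      = (\<integral>\<^sup>+x. \<integral>\<^sup>+y. p x * p y * F (x, y) \<partial>lborel \<partial>lborel)"
    if [measurable]: "F \<in> borel_measurable (borel \<Otimes>\<^sub>M borel)" for F
  proof -
    have "(\<integral>\<^sup>+x. \<integral>\<^sup>+y. F (x, y) \<partial>std_gaussian \<partial>std_gaussian)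
        = (\<integral>\<^sup>+x. p x * (\<integral>\<^sup>+y. F (x, y) \<partial>std_gaussian) \<partial>lborel)"
      unfolding p_def by (rule nn_integral_std_gaussian) measurable
    also have "\<dots> = (\<integral>\<^sup>+x. p x * (\<integral>\<^sup>+y. p y * F (x, y) \<partial>lborel) \<partial>lborel)"
      unfolding p_def by (subst nn_integral_std_gaussian) auto
    also have "\<dots> = (\<integral>\<^sup>+x. \<integral>\<^sup>+y. p x * p y * F (x, y) \<partial>lborel \<partial>lborel)"
      by (simp add: mult.assoc nn_integral_cmult)
    finally show ?thesis .
  qed
  have pp: "p (a *\<^sub>R (x + y)) * p (a *\<^sub>R (x - y)) = p x * p y" for x y
  proof -
    have "- (a *\<^sub>R (x + y) \<bullet> a *\<^sub>R (x + y)) / 2 + - (a *\<^sub>R (x - y) \<bullet> a *\<^sub>R (x - y)) / 2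
       = - (x \<bullet> x) / 2 + - (y \<bullet> y) / 2"
      by (simp add: a_def inner_add inner_diff inner_commute field_simps)
    hence "gauss_density (a *\<^sub>R (x + y)) * gauss_density (a *\<^sub>R (x - y)) = gauss_density x * gauss_density y"
      unfolding gauss_density_def mult.assoc exp_add[symmetric] mult.left_commute[of "exp _"]
      by simp
    thus ?thesis by (simp add: p_def ennreal_mult'[symmetric] gauss_density_nonneg)
  qed
  have "(\<integral>\<^sup>+x. \<integral>\<^sup>+y. f (x, y) \<partial>std_gaussian \<partial>std_gaussian)
      = (\<integral>\<^sup>+u. \<integral>\<^sup>+v. p u * p v * f (u, v) \<partial>lborel \<partial>lborel)"
    by (rule iter) measurable
  also have "\<dots> = (\<integral>\<^sup>+u. ennreal (sqrt 2 ^ CARD('d)) *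
      (\<integral>\<^sup>+x. p u * p (- u + sqrt 2 *\<^sub>R x) * f (u, - u + sqrt 2 *\<^sub>R x) \<partial>lborel) \<partial>lborel)"
  proof (rule nn_integral_cong)
    fix u
    show "(\<integral>\<^sup>+v. p u * p v * f (u, v) \<partial>lborel) = ennreal (sqrt 2 ^ CARD('d)) *
      (\<integral>\<^sup>+x. p u * p (- u + sqrt 2 *\<^sub>R x) * f (u, - u + sqrt 2 *\<^sub>R x) \<partial>lborel)"
      by (subst nn_integral_lborel_affine[where c = "sqrt 2" and t = "- u"]) auto
  qed
  also have "\<dots> = ennreal (sqrt 2 ^ CARD('d)) *
      (\<integral>\<^sup>+u. \<integral>\<^sup>+x. p u * p (- u + sqrt 2 *\<^sub>R x) * f (u, - u + sqrt 2 *\<^sub>R x) \<partial>lborel \<partial>lborel)"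
    by (rule nn_integral_cmult) measurable
  \<comment> \<open>After the exchange of the integrals, \<open>x\<close> is fixed and \<open>u\<close> can be replaced by \<open>a (x + y)\<close>.\<close>
  also have "(\<integral>\<^sup>+u. \<integral>\<^sup>+x. p u * p (- u + sqrt 2 *\<^sub>R x) * f (u, - u + sqrt 2 *\<^sub>R x) \<partial>lborel \<partial>lborel)
     = (\<integral>\<^sup>+x. \<integral>\<^sup>+u. p u * p (- u + sqrt 2 *\<^sub>R x) * f (u, - u + sqrt 2 *\<^sub>R x) \<partial>lborel \<partial>lborel)"
    by (rule lborel_pair.Fubini') measurable
  also have "\<dots> = (\<integral>\<^sup>+x. ennreal (a ^ CARD('d)) * (\<integral>\<^sup>+y. p x * p y
        * f (a *\<^sub>R (x + y), a *\<^sub>R (x - y)) \<partial>lborel) \<partial>lborel)"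
  proof (rule nn_integral_cong)
    fix x
    have "(\<integral>\<^sup>+u. p u * p (- u + sqrt 2 *\<^sub>R x) * f (u, - u + sqrt 2 *\<^sub>R x) \<partial>lborel)
      = ennreal (a ^ CARD('d)) * (\<integral>\<^sup>+y. p (a *\<^sub>R (x + y)) * p (- (a *\<^sub>R (x + y)) + sqrt 2 *\<^sub>R x)
        * f (a *\<^sub>R (x + y), - (a *\<^sub>R (x + y)) + sqrt 2 *\<^sub>R x) \<partial>lborel)"
      using a by (subst nn_integral_lborel_affine[where c = a and t = "a *\<^sub>R x"])
        (auto simp: scaleR_add_right[symmetric])
    thus "(\<integral>\<^sup>+u. p u * p (- u + sqrt 2 *\<^sub>R x) * f (u, - u + sqrt 2 *\<^sub>R x) \<partial>lborel)
      = ennreal (a ^ CARD('d)) * (\<integral>\<^sup>+y. p x * p y * f (a *\<^sub>R (x + y), a *\<^sub>R (x - y)) \<partial>lborel)"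
      by (simp only: id pp)
  qed
  also have "\<dots> = ennreal (a ^ CARD('d)) * (\<integral>\<^sup>+x. \<integral>\<^sup>+y. p x * p y
        * f (a *\<^sub>R (x + y), a *\<^sub>R (x - y)) \<partial>lborel \<partial>lborel)"
    by (rule nn_integral_cmult) measurable
  also have "ennreal (sqrt 2 ^ CARD('d)) * \<dots> = (\<integral>\<^sup>+x. \<integral>\<^sup>+y. p x * p y
        * f (a *\<^sub>R (x + y), a *\<^sub>R (x - y)) \<partial>lborel \<partial>lborel)"
    using a by (simp add: mult.assoc[symmetric] ennreal_mult'[symmetric] power_mult_distrib[symmetric]
      mult.commute)
  also have "\<dots> = (\<integral>\<^sup>+x. \<integral>\<^sup>+y. f (a *\<^sub>R (x + y), a *\<^sub>R (x - y)) \<partial>std_gaussian \<partial>std_gaussian)"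
    using iter[of "\<lambda>(x, y). f (a *\<^sub>R (x + y), a *\<^sub>R (x - y))"] by simp
  finally show ?thesis by (simp add: a_def)
qed

section \<open>Gaussian samples as reweighted noise\<close>

lemma measurable_matrix_vector_mult [measurable (raw)]:
  fixes A :: "real^'n^'m"
  assumes "f \<in> borel_measurable M"
  shows "(\<lambda>x. A *v f x) \<in> borel_measurable M"
  by (rule measurable_compose[OF assms borel_measurable_continuous_onI])
     (rule matrix_vector_mult_linear_continuous_on)

text \<open>The density of \<open>N\<close> independent \<open>N(h, I)\<close> vectors with respect to \<open>N\<close> independent \<open>N(0, I)\<close>
  vectors.\<close>

definition shift_likelihood :: "nat \<Rightarrow> real^'d \<Rightarrow> (nat \<Rightarrow> real^'d) \<Rightarrow> real" where
  "shift_likelihood N h x = exp (h \<bullet> (\<Sum>i<N. x i) - real N * (h \<bullet> h) / 2)"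

lemma measurable_shift_likelihood [measurable (raw)]:
  assumes [measurable]: "h \<in> borel_measurable M" "x \<in> M \<rightarrow>\<^sub>M PiM {..<N} (\<lambda>_. borel)"
  shows "(\<lambda>w. shift_likelihood N (h w) (x w)) \<in> borel_measurable M"
proof -
  have [measurable]: "(\<lambda>w. x w i) \<in> borel_measurable M" if "i \<in> {..<N}" for i
    using measurable_compose[OF assms(2) measurable_component_singleton[OF that]] by simp
  show ?thesis unfolding shift_likelihood_def by measurable
qed

lemma prob_space_gaussian: "prob_space (gaussian \<mu> \<Sigma>)"
  unfolding gaussian_def
  by (rule prob_space.prob_space_distr[OF prob_space_std_gaussian]) measurable

lemma sets_gaussian [measurable_cong, simp]: "sets (gaussian \<mu> \<Sigma>) = sets borel"
  by (simp add: gaussian_def)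

abbreviation noise :: "nat \<Rightarrow> (nat \<Rightarrow> real^'d) measure" where
  "noise N \<equiv> PiM {..<N} (\<lambda>_. std_gaussian)"

lemma sets_noise [measurable_cong]: "sets (noise N) = sets (PiM {..<N} (\<lambda>_. borel))"
  by (rule sets_PiM_cong) auto

lemma prob_space_noise: "prob_space (noise N)"
  by (rule prob_space_PiM) (rule prob_space_std_gaussian)

lemma prob_space_gaussian_sample: "prob_space (gaussian_sample N \<mu> \<Sigma>)"
  unfolding gaussian_sample_def by (rule prob_space_PiM) (rule prob_space_gaussian)

lemma sets_gaussian_sample [measurable_cong, simp]:
  "sets (gaussian_sample N \<mu> \<Sigma>) = sets (PiM {..<N} (\<lambda>_. borel))"
  unfolding gaussian_sample_def by (rule sets_PiM_cong) auto

definition linear_sample :: "nat \<Rightarrow> real^'d^'d \<Rightarrow> (nat \<Rightarrow> real^'d) \<Rightarrow> nat \<Rightarrow> real^'d" where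
  "linear_sample N A x = (\<lambda>i\<in>{..<N}. A *v x i)"

lemma measurable_linear_sample [measurable]:
  "linear_sample N A \<in> PiM {..<N} (\<lambda>_. borel) \<rightarrow>\<^sub>M PiM {..<N} (\<lambda>_. borel)"
  unfolding linear_sample_def by measurable

text \<open>The shift formula is applied in every coordinate. It takes place before the map \<open>A\<close>, because the
  image measure may have no density; this is why only means in the range of \<open>A\<close> occur.\<close>

lemma gaussian_sample_eq:
  "gaussian_sample N (psd_sqrt \<Sigma> *v h) \<Sigma>
   = distr (density (noise N) (\<lambda>x. ennreal (shift_likelihood N h x))) (PiM {..<N} (\<lambda>_. borel))
       (linear_sample N (psd_sqrt \<Sigma>))"
proof -
  let ?A = "psd_sqrt \<Sigma>" and ?\<mu> = "psd_sqrt \<Sigma> *v h"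
  interpret G: product_prob_space "\<lambda>_::nat. gaussian ?\<mu> \<Sigma>" "{..<N}"
    by (intro product_prob_spaceI prob_space_gaussian)
  interpret S: product_prob_space "\<lambda>_::nat. std_gaussian :: (real^'a) measure" "{..<N}"
    by (intro product_prob_spaceI prob_space_std_gaussian)
  let ?w = "\<lambda>g. ennreal (exp (h \<bullet> g - (h \<bullet> h) / 2))"
  show ?thesis unfolding gaussian_sample_def
  proof (rule G.PiM_eqI[symmetric])
    show "sets (distr (density (noise N) (\<lambda>x. ennreal (shift_likelihood N h x)))
        (PiM {..<N} (\<lambda>_. borel)) (linear_sample N ?A)) = sets (PiM {..<N} (\<lambda>_. gaussian ?\<mu> \<Sigma>))"
      unfolding sets_distr by (rule sets_PiM_cong) auto
  next
    fix B assume "\<And>i. i \<in> {..<N} \<Longrightarrow> B i \<in> sets (gaussian ?\<mu> \<Sigma>)"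
    hence B [measurable]: "B i \<in> sets borel" if "i \<in> {..<N}" for i using that by simp
    have BP [measurable]: "Pi\<^sub>E {..<N} B \<in> sets (PiM {..<N} (\<lambda>_. borel))"
      by (intro sets_PiM_I_finite) (auto intro: B)
    have "emeasure (distr (density (noise N) (\<lambda>x. ennreal (shift_likelihood N h x)))
        (PiM {..<N} (\<lambda>_. borel)) (linear_sample N ?A)) (Pi\<^sub>E {..<N} B)
      = (\<integral>\<^sup>+x. indicator (Pi\<^sub>E {..<N} B) x \<partial>distr (density (noise N) (\<lambda>x. ennreal (shift_likelihood N h x)))
        (PiM {..<N} (\<lambda>_. borel)) (linear_sample N ?A))"
      by (rule nn_integral_indicator[symmetric]) simp
    also have "\<dots> = (\<integral>\<^sup>+x. ennreal (shift_likelihood N h x)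
         * indicator (Pi\<^sub>E {..<N} B) (linear_sample N ?A x) \<partial>noise N)"
      by (subst nn_integral_distr, measurable, subst nn_integral_density) auto
    also have "\<dots> = (\<integral>\<^sup>+x. (\<Prod>i<N. ?w (x i) * indicator (B i) (?A *v x i)) \<partial>noise N)"
    proof (rule nn_integral_cong)
      fix x :: "nat \<Rightarrow> real^'a"
      have "ennreal (shift_likelihood N h x) = (\<Prod>i<N. ?w (x i))"
        by (simp add: prod_ennreal exp_sum[symmetric] shift_likelihood_def sum_subtractf inner_sum_right)
      moreover have "(\<Prod>i<N. indicator (B i) (?A *v x i))
          = (indicator (Pi\<^sub>E {..<N} B) (linear_sample N ?A x) :: ennreal)"
        by (auto simp: linear_sample_def indicator_def PiE_iff prod_zero_iff)
      ultimately show "ennreal (shift_likelihood N h x) * indicator (Pi\<^sub>E {..<N} B) (linear_sample N ?A x)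
         = (\<Prod>i<N. ?w (x i) * indicator (B i) (?A *v x i))" by (simp add: prod.distrib)
    qed
    also have "\<dots> = (\<Prod>i<N. \<integral>\<^sup>+g. ?w g * indicator (B i) (?A *v g) \<partial>std_gaussian)"
      by (subst S.product_nn_integral_prod) auto
    also have "\<dots> = (\<Prod>i<N. emeasure (gaussian ?\<mu> \<Sigma>) (B i))"
    proof (rule prod.cong)
      fix i assume "i \<in> {..<N}"
      note [measurable] = B[OF this]
      have "(\<integral>\<^sup>+g. ?w g * indicator (B i) (?A *v g) \<partial>std_gaussian)
         = (\<integral>\<^sup>+g. indicator (B i) (?A *v (h + g)) \<partial>std_gaussian)"
        by (rule std_gaussian_shift[symmetric]) measurable
      also have "\<dots> = (\<integral>\<^sup>+x. indicator (B i) x \<partial>gaussian ?\<mu> \<Sigma>)"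
        unfolding gaussian_def by (subst nn_integral_distr) (auto simp: matrix_vector_right_distrib)
      also have "\<dots> = emeasure (gaussian ?\<mu> \<Sigma>) (B i)" by (rule nn_integral_indicator) simp
      finally show "(\<integral>\<^sup>+g. ?w g * indicator (B i) (?A *v g) \<partial>std_gaussian)
         = emeasure (gaussian ?\<mu> \<Sigma>) (B i)" .
    qed simp
    finally show "emeasure (distr (density (noise N) (\<lambda>x. ennreal (shift_likelihood N h x)))
        (PiM {..<N} (\<lambda>_. borel)) (linear_sample N ?A)) (Pi\<^sub>E {..<N} B)
      = (\<Prod>i<N. emeasure (gaussian ?\<mu> \<Sigma>) (B i))" .
  qed simp
qed

lemma nn_integral_gaussian_sample:
  assumes f [measurable]: "f \<in> borel_measurable (PiM {..<N} (\<lambda>_. borel))"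
  shows "(\<integral>\<^sup>+X. f X \<partial>gaussian_sample N (psd_sqrt \<Sigma> *v h) \<Sigma>)
       = (\<integral>\<^sup>+x. ennreal (shift_likelihood N h x) * f (linear_sample N (psd_sqrt \<Sigma>) x) \<partial>noise N)"
  unfolding gaussian_sample_eq
  by (subst nn_integral_distr, measurable, subst nn_integral_density) auto

lemma nn_integral_shift_likelihood:
  "(\<integral>\<^sup>+x. ennreal (shift_likelihood N (h::real^'d) x) \<partial>noise N) = 1"
proof -
  interpret prob_space "gaussian_sample N (psd_sqrt (mat 1) *v h) (mat 1)"
    by (rule prob_space_gaussian_sample)
  have "(\<integral>\<^sup>+x. ennreal (shift_likelihood N h x) * 1 \<partial>noise N)
      = (\<integral>\<^sup>+X. 1 \<partial>gaussian_sample N (psd_sqrt (mat 1) *v h) (mat 1))"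
    by (rule nn_integral_gaussian_sample[symmetric]) measurable
  also have "\<dots> = 1" by (simp add: emeasure_space_1)
  finally show ?thesis by simp
qed

text \<open>The square of the likelihood of \<open>h\<close> is a multiple of the likelihood of \<open>2 h\<close>.\<close>

lemma nn_integral_shift_likelihood_square:
  "(\<integral>\<^sup>+x. ennreal ((shift_likelihood N (h::real^'d) x)\<^sup>2) \<partial>noise N) = ennreal (exp (real N * (h \<bullet> h)))"
proof -
  have "(shift_likelihood N h x)\<^sup>2 = exp (real N * (h \<bullet> h)) * shift_likelihood N (2 *\<^sub>R h) x" for x
    by (simp add: shift_likelihood_def power2_eq_square exp_add[symmetric] algebra_simps)
  hence "(\<integral>\<^sup>+x. ennreal ((shift_likelihood N h x)\<^sup>2) \<partial>noise N)
     = (\<integral>\<^sup>+x. ennreal (exp (real N * (h \<bullet> h))) * ennreal (shift_likelihood N (2 *\<^sub>R h) x) \<partial>noise N)"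
    by (simp add: ennreal_mult')
  thus ?thesis by (simp add: nn_integral_cmult nn_integral_shift_likelihood)
qed

text \<open>The likelihood \<open>L\<close> satisfies \<open>L \<le> l / 2 + L\<^sup>2 / (2 l)\<close>, so a bound on its second moment controls
  how much more likely an event becomes when the mean is moved. Optimising over \<open>l\<close> would give the
  Cauchy-Schwarz bound.\<close>

lemma change_of_measure:
  assumes E [measurable]: "E \<in> sets (PiM {..<N} (\<lambda>_. borel))" and l: "l > 0"
  shows "measure (gaussian_sample N (psd_sqrt \<Sigma> *v h) \<Sigma>) E
     \<le> l / 2 * measure (gaussian_sample N 0 \<Sigma>) E + exp (real N * (h \<bullet> h)) / (2 * l)"
proof -
  let ?A = "psd_sqrt \<Sigma>"
  interpret H: prob_space "gaussian_sample N (?A *v h) \<Sigma>" by (rule prob_space_gaussian_sample)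
  interpret O: prob_space "gaussian_sample N 0 \<Sigma>" by (rule prob_space_gaussian_sample)
  have em: "emeasure (gaussian_sample N (?A *v g) \<Sigma>) E
     = (\<integral>\<^sup>+x. ennreal (shift_likelihood N g x) * indicator E (linear_sample N ?A x) \<partial>noise N)" for g
    by (subst nn_integral_gaussian_sample[symmetric]) auto
  have "emeasure (gaussian_sample N (?A *v h) \<Sigma>) E
     \<le> (\<integral>\<^sup>+x. ennreal (l / 2) * indicator E (linear_sample N ?A x)
          + ennreal (1 / (2 * l)) * ennreal ((shift_likelihood N h x)\<^sup>2) \<partial>noise N)"
    unfolding em
  proof (rule nn_integral_mono)
    fix x :: "nat \<Rightarrow> real^'a"
    let ?L = "shift_likelihood N h x"
    have "0 \<le> (?L - l)\<^sup>2 / (2 * l)" using l by simp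
    also have "\<dots> = l / 2 + 1 / (2 * l) * ?L\<^sup>2 - ?L"
      using l by (simp add: power2_eq_square field_simps)
    finally have "ennreal ?L \<le> ennreal (l / 2 + 1 / (2 * l) * ?L\<^sup>2)" by (intro ennreal_leI) simp
    also have "\<dots> = ennreal (l / 2) + ennreal (1 / (2 * l)) * ennreal (?L\<^sup>2)"
      using l by (subst ennreal_plus) (auto simp: ennreal_mult'[symmetric])
    finally show "ennreal ?L * indicator E (linear_sample N ?A x) \<le> ennreal (l / 2) * indicator E (linear_sample N ?A x)
          + ennreal (1 / (2 * l)) * ennreal (?L\<^sup>2)"
      by (simp add: indicator_def)
  qed
  also have "\<dots> = ennreal (l / 2) * emeasure (gaussian_sample N 0 \<Sigma>) E
       + ennreal (1 / (2 * l)) * ennreal (exp (real N * (h \<bullet> h)))"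
    using em[of 0] by (simp add: nn_integral_add nn_integral_cmult nn_integral_shift_likelihood_square
        shift_likelihood_def[of N 0])
  also have "\<dots> = ennreal (l / 2 * measure (gaussian_sample N 0 \<Sigma>) E + exp (real N * (h \<bullet> h)) / (2 * l))"
    using l by (simp add: O.emeasure_eq_measure ennreal_plus ennreal_mult'[symmetric])
  finally show ?thesis using l
    unfolding H.emeasure_eq_measure by (subst (asm) ennreal_le_iff) auto
qed

section \<open>Averaging over a Gaussian prior\<close>

text \<open>Bayes' formula for the prior \<open>N(0, I / k)\<close>: the joint law of parameter and data is disintegrated
  first along the parameter, then along the data. The weight \<open>Z x\<close> is the marginal density of the
  data, and given the data the parameter is \<open>m (y + m (x\<^sub>1 + \<dots> + x\<^sub>N))\<close> with \<open>y\<close> standard Gaussian. The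
  spread \<open>m\<close> does not depend on the data.\<close>

lemma bayes_gaussian_prior:
  fixes q :: "(nat \<Rightarrow> real^'d) \<times> (real^'d) \<Rightarrow> ennreal" and k :: real
  assumes q [measurable]: "q \<in> borel_measurable (PiM {..<N} (\<lambda>_. borel) \<Otimes>\<^sub>M borel)" and k: "k > 0"
  defines "m \<equiv> 1 / sqrt (k + real N)"
  defines "Z \<equiv> \<lambda>x. (sqrt k * m) ^ CARD('d) * exp (((\<Sum>i<N. x i) \<bullet> (\<Sum>i<N. x i)) * m\<^sup>2 / 2)"
  shows "(\<integral>\<^sup>+g. \<integral>\<^sup>+x. ennreal (shift_likelihood N ((1 / sqrt k) *\<^sub>R g) x)
            * q (x, (1 / sqrt k) *\<^sub>R g) \<partial>noise N \<partial>std_gaussian)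
       = (\<integral>\<^sup>+x. ennreal (Z x) * (\<integral>\<^sup>+y. q (x, m *\<^sub>R (y + m *\<^sub>R (\<Sum>i<N. x i))) \<partial>std_gaussian) \<partial>noise N)"
proof -
  interpret G: prob_space "std_gaussian :: (real^'d) measure" by (rule prob_space_std_gaussian)
  interpret X: prob_space "noise N :: (nat \<Rightarrow> real^'d) measure" by (rule prob_space_noise)
  interpret P: pair_sigma_finite "noise N :: (nat \<Rightarrow> real^'d) measure" "std_gaussian :: (real^'d) measure" ..
  define c where "c = sqrt (k + real N) / sqrt k"
  have c: "c > 0" "c\<^sup>2 - 1 = real N / k" "1 / c = sqrt k * m" "1 / c\<^sup>2 = k * m\<^sup>2"
    using k by (auto simp: c_def m_def power_divide field_simps)
  have km: "(1 / sqrt k) * (1 / c) = m" "(1 / c) * (1 / sqrt k) = m"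
    using k by (auto simp: c(3))
  have "(\<integral>\<^sup>+g. \<integral>\<^sup>+x. ennreal (shift_likelihood N ((1 / sqrt k) *\<^sub>R g) x)
            * q (x, (1 / sqrt k) *\<^sub>R g) \<partial>noise N \<partial>std_gaussian)
     = (\<integral>\<^sup>+x. \<integral>\<^sup>+g. ennreal (shift_likelihood N ((1 / sqrt k) *\<^sub>R g) x)
            * q (x, (1 / sqrt k) *\<^sub>R g) \<partial>std_gaussian \<partial>noise N)"
    by (rule P.Fubini') measurable
  also have "\<dots> = (\<integral>\<^sup>+x. ennreal (Z x) * (\<integral>\<^sup>+y. q (x, m *\<^sub>R (y + m *\<^sub>R (\<Sum>i<N. x i))) \<partial>std_gaussian) \<partial>noise N)"
  proof (rule nn_integral_cong)
    fix x assume x: "x \<in> space (noise N :: (nat \<Rightarrow> real^'d) measure)"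
    hence x' [measurable]: "x \<in> space (PiM {..<N} (\<lambda>_. borel))"
      using sets_eq_imp_space_eq[OF sets_noise] by blast
    let ?s = "\<Sum>i<N. x i"
    let ?u = "(1 / sqrt k) *\<^sub>R ?s"
    have lik: "shift_likelihood N ((1 / sqrt k) *\<^sub>R g) x = exp (?u \<bullet> g - (c\<^sup>2 - 1) * (g \<bullet> g) / 2)" for g
      using k by (simp add: shift_likelihood_def c(2) inner_commute)
    have "(\<integral>\<^sup>+g. ennreal (shift_likelihood N ((1 / sqrt k) *\<^sub>R g) x)
            * q (x, (1 / sqrt k) *\<^sub>R g) \<partial>std_gaussian)
        = ennreal ((1 / c) ^ CARD('d) * exp ((?u \<bullet> ?u) / (2 * c\<^sup>2)))
         * (\<integral>\<^sup>+y. q (x, (1 / sqrt k) *\<^sub>R ((1 / c) *\<^sub>R (y + (1 / c) *\<^sub>R ?u))) \<partial>std_gaussian)"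
      unfolding lik by (rule std_gaussian_tilt[OF _ c(1)]) measurable
    also have "(?u \<bullet> ?u) / (2 * c\<^sup>2) = (?s \<bullet> ?s) * m\<^sup>2 / 2"
    proof -
      have "(?u \<bullet> ?u) / (2 * c\<^sup>2) = (?s \<bullet> ?s) / k * (1 / c\<^sup>2) / 2" using k by simp
      thus ?thesis using k by (simp add: c(4))
    qed
    also have "(1 / c) ^ CARD('d) * exp ((?s \<bullet> ?s) * m\<^sup>2 / 2) = Z x" by (simp add: Z_def c(3))
    also have "(\<lambda>y. q (x, (1 / sqrt k) *\<^sub>R ((1 / c) *\<^sub>R (y + (1 / c) *\<^sub>R ?u))))
        = (\<lambda>y. q (x, m *\<^sub>R (y + m *\<^sub>R ?s)))"
      by (simp only: scaleR_scaleR km)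
    finally show "(\<integral>\<^sup>+g. ennreal (shift_likelihood N ((1 / sqrt k) *\<^sub>R g) x)
            * q (x, (1 / sqrt k) *\<^sub>R g) \<partial>std_gaussian)
      = ennreal (Z x) * (\<integral>\<^sup>+y. q (x, m *\<^sub>R (y + m *\<^sub>R ?s)) \<partial>std_gaussian)" .
  qed
  finally show ?thesis .
qed

text \<open>If every posterior gave the set \<open>Q\<close> less than mass \<open>p\<close>, then so would their average with respect to
  the marginal density of the data; but this average is also the average of the frequentist
  coverages over the prior.\<close>

lemma posterior_coverage:
  fixes Q :: "((nat \<Rightarrow> real^'d) \<times> (real^'d)) set" and k :: real and p :: ennreal
  assumes Q [measurable]: "Q \<in> sets (PiM {..<N} (\<lambda>_. borel) \<Otimes>\<^sub>M borel)" and k: "k > 0" and p: "p < top"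
    and cov: "\<And>h. p \<le> (\<integral>\<^sup>+x. ennreal (shift_likelihood N h x) * indicator Q (x, h) \<partial>noise N)"
  shows "\<exists>x b. p \<le> emeasure std_gaussian {y. (x, (1 / sqrt (k + real N)) *\<^sub>R (y + b)) \<in> Q}"
proof (rule ccontr)
  assume "\<not> ?thesis"
  hence less: "emeasure std_gaussian {y. (x, (1 / sqrt (k + real N)) *\<^sub>R (y + b)) \<in> Q} < p" for x b
    by (simp add: not_le)
  define m where "m = 1 / sqrt (k + real N)"
  define Z :: "(nat \<Rightarrow> real^'d) \<Rightarrow> real" where
    "Z x = (sqrt k * m) ^ CARD('d) * exp (((\<Sum>i<N. x i) \<bullet> (\<Sum>i<N. x i)) * m\<^sup>2 / 2)" for x
  define P where "P x = (\<integral>\<^sup>+y. indicator Q (x, m *\<^sub>R (y + m *\<^sub>R (\<Sum>i<N. x i))) \<partial>std_gaussian)" for x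
  interpret G: prob_space "std_gaussian :: (real^'d) measure" by (rule prob_space_std_gaussian)
  interpret X: prob_space "noise N :: (nat \<Rightarrow> real^'d) measure" by (rule prob_space_noise)
  have [measurable]: "(\<lambda>x. \<Sum>i<N. x i) \<in> borel_measurable (PiM {..<N} (\<lambda>_. borel :: (real^'d) measure))"
    by measurable
  have Zm [measurable]: "Z \<in> borel_measurable (PiM {..<N} (\<lambda>_. borel))" unfolding Z_def by measurable
  have Pm [measurable]: "P \<in> borel_measurable (noise N)" unfolding P_def by measurable
  have Z0: "Z x > 0" for x using k by (simp add: Z_def m_def)
  have "1 = (\<integral>\<^sup>+g. \<integral>\<^sup>+x. ennreal (shift_likelihood N ((1 / sqrt k) *\<^sub>R g) x) * 1 \<partial>noise N
            \<partial>(std_gaussian :: (real^'d) measure))"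
    by (simp add: nn_integral_shift_likelihood G.emeasure_space_1[simplified])
  also have "\<dots> = (\<integral>\<^sup>+x. ennreal (Z x) * (\<integral>\<^sup>+y. 1 \<partial>(std_gaussian :: (real^'d) measure)) \<partial>noise N)"
    unfolding Z_def m_def by (rule bayes_gaussian_prior[OF _ k]) measurable
  finally have Z1: "(\<integral>\<^sup>+x. ennreal (Z x) \<partial>noise N) = 1"
    by (simp add: G.emeasure_space_1[simplified])
  have "p = (\<integral>\<^sup>+g. p \<partial>(std_gaussian :: (real^'d) measure))"
    by (simp add: G.emeasure_space_1[simplified])
  also have "\<dots> \<le> (\<integral>\<^sup>+g. \<integral>\<^sup>+x. ennreal (shift_likelihood N ((1 / sqrt k) *\<^sub>R g) x)
            * indicator Q (x, (1 / sqrt k) *\<^sub>R g) \<partial>noise N \<partial>std_gaussian)"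
    by (intro nn_integral_mono cov)
  also have "\<dots> = (\<integral>\<^sup>+x. ennreal (Z x) * P x \<partial>noise N)"
    unfolding Z_def P_def m_def by (rule bayes_gaussian_prior[OF _ k]) measurable
  finally have ge: "p \<le> (\<integral>\<^sup>+x. ennreal (Z x) * P x \<partial>noise N)" .
  have Zp: "(\<integral>\<^sup>+x. ennreal (Z x) * p \<partial>noise N) = p"
    by (subst nn_integral_multc) (auto simp: Z1)
  have lt: "ennreal (Z x) * P x < ennreal (Z x) * p" if "x \<in> space (noise N)" for x
  proof (rule ennreal_mult_strict_left_mono)
    have x [measurable]: "x \<in> space (PiM {..<N} (\<lambda>_. borel))"
      using that sets_eq_imp_space_eq[OF sets_noise] by blast
    have "P x = (\<integral>\<^sup>+y. indicator {y. (x, m *\<^sub>R (y + m *\<^sub>R (\<Sum>i<N. x i))) \<in> Q} y \<partial>std_gaussian)"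
      unfolding P_def by (intro nn_integral_cong) (simp add: indicator_def)
    also have "\<dots> = emeasure std_gaussian {y. (x, m *\<^sub>R (y + m *\<^sub>R (\<Sum>i<N. x i))) \<in> Q}"
      by (rule nn_integral_indicator) measurable
    finally show "P x < p" using less by (simp add: m_def)
  qed (use Z0 in auto)
  have le: "(\<integral>\<^sup>+x. ennreal (Z x) * P x \<partial>noise N) \<le> (\<integral>\<^sup>+x. ennreal (Z x) * p \<partial>noise N)"
    by (intro nn_integral_mono less_imp_le lt)
  have "(\<integral>\<^sup>+x. ennreal (Z x) * P x \<partial>noise N) < (\<integral>\<^sup>+x. ennreal (Z x) * p \<partial>noise N)"
  proof (rule nn_integral_less)
    show "(\<integral>\<^sup>+x. ennreal (Z x) * P x \<partial>noise N) \<noteq> \<infinity>" using le p by (auto simp: Zp top_unique)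
    show "AE x in noise N. ennreal (Z x) * P x \<le> ennreal (Z x) * p"
      by (intro AE_I2 less_imp_le lt)
    show "\<not> (AE x in noise N. ennreal (Z x) * p \<le> ennreal (Z x) * P x)"
    proof
      assume "AE x in noise N. ennreal (Z x) * p \<le> ennreal (Z x) * P x"
      hence "AE x in noise N :: (nat \<Rightarrow> real^'d) measure. False"
        using AE_space
      proof eventually_elim
        case (elim x)
        thus ?case using lt[of x] by (simp add: not_le[symmetric])
      qed
      thus False using X.AE_False by blast
    qed
  qed measurable
  with ge show False by (simp add: Zp)
qed

section \<open>Seminorms with values in the extended half-line\<close>

lemma measurable_sup_norm_on [measurable]:
  "sup_norm_on (S :: 'a::euclidean_space set) \<in> borel_measurable borel"
proof (rule borel_measurableI_greater)
  fix t :: ereal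
  have "continuous_on UNIV (\<lambda>x. ereal (v \<bullet> x))" for v :: 'a
    by (intro continuous_on_ereal continuous_intros)
  hence "open {x. t < ereal (v \<bullet> x)}" for v :: 'a
    by (intro open_Collect_less continuous_on_const)
  hence "open (\<Union>v\<in>S. {x. t < ereal (v \<bullet> x)})" by blast
  moreover have "{x \<in> space borel. t < sup_norm_on S x} = (\<Union>v\<in>S. {x. t < ereal (v \<bullet> x)})"
    by (auto simp: sup_norm_on_def less_SUP_iff)
  ultimately show "{x \<in> space borel. t < sup_norm_on S x} \<in> sets borel" by simp
qed

lemma sup_norm_on_abs_le:
  assumes "symmetric_set S" "v \<in> S" "sup_norm_on S x \<le> ereal r"
  shows "\<bar>v \<bullet> x\<bar> \<le> r"
proof -
  have *: "u \<bullet> x \<le> r" if "u \<in> S" for u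
    using assms(3) that unfolding sup_norm_on_def SUP_le_iff by auto
  from *[OF assms(2)] *[of "- v"] assms(1,2) show ?thesis by (auto simp: symmetric_set_def)
qed

text \<open>The functional \<open>sup_norm_on S\<close> with values in \<^typ>\<open>ennreal\<close>, the type in which nonnegative integrals
  live. Negative inner products are truncated to zero, which changes nothing when \<open>S\<close> is nonempty
  and symmetric.\<close>

definition dual_seminorm :: "'a::real_inner set \<Rightarrow> 'a \<Rightarrow> ennreal" where
  "dual_seminorm S x = (SUP v\<in>S. ennreal (v \<bullet> x))"

lemma dual_seminorm_le_iff:
  "0 \<le> c \<Longrightarrow> dual_seminorm S x \<le> ennreal c \<longleftrightarrow> sup_norm_on S x \<le> ereal c"
  by (simp add: dual_seminorm_def sup_norm_on_def SUP_le_iff ennreal_le_iff)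

lemma e2ennreal_sup_norm_on: "e2ennreal (sup_norm_on S x) = dual_seminorm S x"
proof (rule antisym)
  show "e2ennreal (sup_norm_on S x) \<le> dual_seminorm S x"
  proof (cases "dual_seminorm S x")
    case (real c)
    hence "sup_norm_on S x \<le> ereal c" using dual_seminorm_le_iff[of c S x] by simp
    from e2ennreal_mono[OF this] show ?thesis using real by simp
  qed simp
next
  show "dual_seminorm S x \<le> e2ennreal (sup_norm_on S x)"
    unfolding dual_seminorm_def
  proof (rule SUP_least)
    fix v assume "v \<in> S"
    hence "ereal (v \<bullet> x) \<le> sup_norm_on S x" unfolding sup_norm_on_def by (rule SUP_upper)
    from e2ennreal_mono[OF this] show "ennreal (v \<bullet> x) \<le> e2ennreal (sup_norm_on S x)" by simp
  qed
qed

lemma measurable_dual_seminorm [measurable]: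
  "dual_seminorm (S :: 'a::euclidean_space set) \<in> borel_measurable borel"
  unfolding e2ennreal_sup_norm_on[symmetric] by measurable

lemma dual_seminorm_triangle: "dual_seminorm S (x + y) \<le> dual_seminorm S x + dual_seminorm S y"
  unfolding dual_seminorm_def
proof (rule SUP_least)
  fix v assume v: "v \<in> S"
  have "ennreal (v \<bullet> (x + y)) \<le> ennreal (v \<bullet> x) + ennreal (v \<bullet> y)"
    by (auto simp: inner_add_right ennreal_plus_if intro!: ennreal_leI)
  also have "\<dots> \<le> (SUP v\<in>S. ennreal (v \<bullet> x)) + (SUP v\<in>S. ennreal (v \<bullet> y))"
    using v by (intro add_mono SUP_upper)
  finally show "ennreal (v \<bullet> (x + y)) \<le> \<dots>" .
qed

lemma dual_seminorm_scale:
  "0 \<le> c \<Longrightarrow> dual_seminorm S (c *\<^sub>R x) = ennreal c * dual_seminorm S x"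
  by (simp add: dual_seminorm_def SUP_mult_left_ennreal ennreal_mult')

lemma dual_seminorm_uminus:
  assumes "symmetric_set S"
  shows "dual_seminorm S (- x) = dual_seminorm S x"
proof -
  have "uminus ` S = S" using assms by (force simp: symmetric_set_def image_iff)
  hence "(SUP v\<in>S. ennreal (v \<bullet> (-x))) = (SUP v\<in>uminus ` S. ennreal (v \<bullet> (-x)))" by simp
  thus ?thesis by (simp add: dual_seminorm_def image_image)
qed

text \<open>The value \<open>\<infinity>\<close> is admitted because the dual seminorm of an unbounded set takes it.\<close>

definition extended_seminorm :: "('a::real_vector \<Rightarrow> ennreal) \<Rightarrow> bool" where
  "extended_seminorm W \<longleftrightarrow> (\<forall>x y. W (x + y) \<le> W x + W y)
     \<and> (\<forall>c x. 0 \<le> c \<longrightarrow> W (c *\<^sub>R x) = ennreal c * W x) \<and> (\<forall>x. W (- x) = W x)"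

lemma extended_seminorm_dual_seminorm: "symmetric_set S \<Longrightarrow> extended_seminorm (dual_seminorm S)"
  by (auto simp: extended_seminorm_def dual_seminorm_triangle dual_seminorm_scale dual_seminorm_uminus)

lemma extended_seminorm_compose_matrix:
  fixes A :: "real^'n^'m"
  assumes "extended_seminorm V"
  shows "extended_seminorm (\<lambda>x. V (A *v x))"
  using assms by (auto simp: extended_seminorm_def matrix_vector_right_distrib linear_neg[OF matrix_vector_mul_linear]
      matrix_vector_mult_scaleR)

section \<open>From quantiles to means\<close>

text \<open>Let \<open>x, y\<close> be independent standard Gaussians, \<open>u = (x + y) / sqrt 2\<close> and \<open>v = (x - y) / sqrt 2\<close>;
  these are again independent standard Gaussians. Since \<open>v = sqrt 2 x - u = u - sqrt 2 y\<close>, on the event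
  \<open>W u \<le> s\<close> the value \<open>W v\<close> is at most \<open>s + sqrt 2 min (W x) (W y)\<close>, and this minimum exceeds \<open>s\<close> only
  if \<open>W y > s\<close>, an event of probability at most \<open>1/4\<close> that is independent of \<open>W x\<close>. Integration bounds the mean \<open>e\<close> by a
  multiple of \<open>s\<close> plus a fraction of \<open>e\<close> itself, and that fraction is below one. Truncation at \<open>n\<close>
  makes \<open>e\<close> finite, so that it can be absorbed.\<close>

lemma truncated_gaussian_mean_le_quantile:
  fixes W :: "real^'d \<Rightarrow> ennreal"
  assumes [measurable]: "W \<in> borel_measurable borel" and W: "extended_seminorm W"
    and s: "0 \<le> s" and B: "emeasure std_gaussian {x. W x \<le> ennreal s} \<ge> ennreal (3/4)"
  shows "(\<integral>\<^sup>+x. min (W x) (of_nat n) \<partial>std_gaussian) \<le> ennreal (11/2 * s)"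
proof -
  interpret G: prob_space "std_gaussian :: (real^'d) measure" by (rule prob_space_std_gaussian)
  define w where "w x = min (W x) (of_nat n)" for x
  have [measurable]: "w \<in> borel_measurable borel" unfolding w_def by measurable
  let ?B = "{x. W x \<le> ennreal s}"
  have Bm [measurable]: "?B \<in> sets borel" by measurable
  define p where "p = G.prob ?B"
  define e where "e = enn2real (\<integral>\<^sup>+x. w x \<partial>std_gaussian)"
  have p: "emeasure std_gaussian ?B = ennreal p" by (simp add: p_def G.emeasure_eq_measure)
  have p34: "p \<ge> 3/4" using B unfolding p by (simp add: p_def)
  have p1: "p \<le> 1" by (simp add: p_def)
  have "emeasure std_gaussian (space std_gaussian - ?B) = ennreal (1 - p)"
    using G.prob_compl[of ?B] by (simp add: G.emeasure_eq_measure p_def)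
  hence pc: "emeasure std_gaussian (- ?B) = ennreal (1 - p)" by (simp add: Compl_eq_Diff_UNIV)
  have "(\<integral>\<^sup>+x. w x \<partial>std_gaussian) \<le> (\<integral>\<^sup>+x. of_nat n \<partial>(std_gaussian :: (real^'d) measure))"
    by (intro nn_integral_mono) (simp add: w_def)
  also have "\<dots> = of_nat n" by (simp add: G.emeasure_space_1[simplified])
  finally have "(\<integral>\<^sup>+x. w x \<partial>std_gaussian) < top"
    by (meson ennreal_of_nat_neq_top le_less_trans less_top)
  hence e: "(\<integral>\<^sup>+x. w x \<partial>std_gaussian) = ennreal e" by (simp add: e_def)
  have e0: "e \<ge> 0" by (simp add: e_def)
  have tri: "W (x + y) \<le> W x + W y" for x y using W by (auto simp: extended_seminorm_def)
  have scale: "W (c *\<^sub>R x) = ennreal c * W x" if "0 \<le> c" for c x using W that by (auto simp: extended_seminorm_def)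
  have scale2: "W (sqrt 2 *\<^sub>R x) = ennreal (sqrt 2) * W x" for x by (rule scale) simp
  have neg: "W (- x) = W x" for x using W by (auto simp: extended_seminorm_def)
  have key: "indicator ?B ((1 / sqrt 2) *\<^sub>R (x + y)) * w ((1 / sqrt 2) *\<^sub>R (x - y))
      \<le> indicator ?B ((1 / sqrt 2) *\<^sub>R (x + y)) * ennreal s
        + ennreal (sqrt 2) * (ennreal s + indicator (- ?B) y * w x)" for x y
  proof (cases "(1 / sqrt 2) *\<^sub>R (x + y) \<in> ?B")
    case True
    let ?u = "(1 / sqrt 2) *\<^sub>R (x + y)" and ?v = "(1 / sqrt 2) *\<^sub>R (x - y)"
    have "1 / sqrt 2 + 1 / sqrt 2 = sqrt (2::real)" by (simp add: field_simps)
    hence r2: "sqrt 2 *\<^sub>R z = (1 / sqrt 2) *\<^sub>R z + (1 / sqrt 2) *\<^sub>R z" for z :: "real^'d"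
      by (metis scaleR_add_left)
    have v1: "?v = sqrt 2 *\<^sub>R x + - ?u"
      unfolding r2 by (simp add: scaleR_add_right scaleR_diff_right)
    have v2: "?v = ?u + sqrt 2 *\<^sub>R (- y)"
      unfolding r2 by (simp add: scaleR_add_right scaleR_diff_right)
    have u: "W ?u \<le> ennreal s" using True by simp
    have "W ?v \<le> ennreal (sqrt 2) * W x + W ?u"
      using tri[of "sqrt 2 *\<^sub>R x" "- ?u"] by (simp only: v1[symmetric] neg scale2)
    also have "\<dots> \<le> ennreal (sqrt 2) * W x + ennreal s" using u by (intro add_left_mono)
    finally have Wx: "W ?v \<le> ennreal s + ennreal (sqrt 2) * W x" by (simp add: add.commute)
    have "W ?v \<le> W ?u + ennreal (sqrt 2) * W y"
      using tri[of ?u "sqrt 2 *\<^sub>R (- y)"] by (simp only: v2[symmetric] neg scale2)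
    also have "\<dots> \<le> ennreal s + ennreal (sqrt 2) * W y" using u by (intro add_right_mono)
    finally have Wy: "W ?v \<le> ennreal s + ennreal (sqrt 2) * W y" .
    have main: "w ?v \<le> ennreal s + ennreal (sqrt 2) * (ennreal s + indicator (- ?B) y * w x)"
    proof (cases "y \<in> ?B")
      case True
      have "w ?v \<le> W ?v" by (simp add: w_def)
      also note Wy
      also have "ennreal s + ennreal (sqrt 2) * W y \<le> ennreal s + ennreal (sqrt 2) * ennreal s"
        using True by (intro add_left_mono mult_left_mono) auto
      finally show ?thesis using True by simp
    next
      case False
      have "w ?v \<le> ennreal s + ennreal (sqrt 2) * w x"
      proof (cases "W x \<le> of_nat n")
        case True
        hence "w x = W x" by (simp add: w_def)
        moreover have "w ?v \<le> W ?v" by (simp add: w_def)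
        ultimately show ?thesis using Wx by (metis order_trans)
      next
        case False
        hence "w x = of_nat n" by (simp add: w_def min_def)
        moreover have "w ?v \<le> 1 * of_nat n" by (simp add: w_def)
        moreover have "1 * of_nat n \<le> ennreal (sqrt 2) * of_nat n"
          by (intro mult_right_mono) (simp_all flip: ennreal_1)
        ultimately have "w ?v \<le> 0 + ennreal (sqrt 2) * w x" by simp
        also have "\<dots> \<le> ennreal s + ennreal (sqrt 2) * w x" by (intro add_right_mono) simp
        finally show ?thesis .
      qed
      also have "\<dots> \<le> ennreal s + ennreal (sqrt 2) * (ennreal s + w x)"
        by (intro add_left_mono mult_left_mono) auto
      finally show ?thesis using False by simp
    qed
    show ?thesis using main True by simp
  next
    case False thus ?thesis by simp
  qed
  have "ennreal (p * e) = (\<integral>\<^sup>+x. \<integral>\<^sup>+y. indicator ?B x * w y \<partial>std_gaussian \<partial>std_gaussian)"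
    using e0 p34 by (simp add: nn_integral_cmult nn_integral_multc e p ennreal_mult')
  also have "\<dots> = (\<integral>\<^sup>+x. \<integral>\<^sup>+y. indicator ?B ((1 / sqrt 2) *\<^sub>R (x + y)) * w ((1 / sqrt 2) *\<^sub>R (x - y))
      \<partial>std_gaussian \<partial>std_gaussian)"
    using std_gaussian_rotation[of "\<lambda>(x, y). indicator ?B x * w y"] by simp
  also have "\<dots> \<le> (\<integral>\<^sup>+x. \<integral>\<^sup>+y. indicator ?B ((1 / sqrt 2) *\<^sub>R (x + y)) * ennreal s
        + ennreal (sqrt 2) * (ennreal s + indicator (- ?B) y * w x) \<partial>std_gaussian \<partial>std_gaussian)"
    by (intro nn_integral_mono key)
  also have "\<dots> = (\<integral>\<^sup>+x. \<integral>\<^sup>+y. indicator ?B ((1 / sqrt 2) *\<^sub>R (x + y)) * ennreal s \<partial>std_gaussian \<partial>std_gaussian)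
        + (\<integral>\<^sup>+x. \<integral>\<^sup>+y. ennreal (sqrt 2) * (ennreal s + indicator (- ?B) y * w x) \<partial>std_gaussian \<partial>std_gaussian)"
    by (simp add: nn_integral_add)
  also have "(\<integral>\<^sup>+x. \<integral>\<^sup>+y. indicator ?B ((1 / sqrt 2) *\<^sub>R (x + y)) * ennreal s \<partial>std_gaussian \<partial>std_gaussian)
      = (\<integral>\<^sup>+x. \<integral>\<^sup>+y. indicator ?B x * ennreal s \<partial>(std_gaussian :: (real^'d) measure) \<partial>(std_gaussian :: (real^'d) measure))"
    using std_gaussian_rotation[of "\<lambda>(x, y). indicator ?B x * ennreal s"] by simp
  also have "\<dots> = ennreal (p * s)"
    using s p34 by (simp add: nn_integral_multc p ennreal_mult' G.emeasure_space_1[simplified])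
  also have "(\<integral>\<^sup>+x. \<integral>\<^sup>+y. ennreal (sqrt 2) * (ennreal s + indicator (- ?B) y * w x) \<partial>std_gaussian \<partial>std_gaussian)
      = ennreal (sqrt 2 * (s + (1 - p) * e))"
    using s e0 p1 by (simp add: nn_integral_cmult nn_integral_multc nn_integral_add pc e
        G.emeasure_space_1[simplified] ennreal_mult')
  finally have "ennreal (p * e) \<le> ennreal (p * s + sqrt 2 * (s + (1 - p) * e))"
    using s e0 p1 p34 by (simp flip: ennreal_plus)
  hence ineq: "p * e \<le> p * s + sqrt 2 * (s + (1 - p) * e)"
    using s e0 p1 p34 by (subst (asm) ennreal_le_iff) auto
  \<comment> \<open>With \<open>sqrt 2 \<le> 71/50\<close> and \<open>p \<ge> 3/4\<close>, the inequality can be solved for \<open>e\<close>.\<close>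
  have sq: "sqrt 2 \<le> 71/50" by (rule real_le_lsqrt) (auto simp: power2_eq_square)
  have "sqrt 2 * (s + (1 - p) * e) \<le> 71/50 * (s + (1 - p) * e)"
    using s e0 p1 by (intro mult_right_mono sq) auto
  hence "p * e \<le> p * s + 71/50 * (s + (1 - p) * e)" using ineq by linarith
  hence *: "(121/50 * p - 71/50) * e \<le> (p + 71/50) * s" by (simp add: field_simps)
  have "(p + 71/50) * s \<le> ((121/50 * p - 71/50) * (11/2)) * s"
    using s p34 by (intro mult_right_mono) auto
  from order_trans[OF * this] have "(121/50 * p - 71/50) * e \<le> (121/50 * p - 71/50) * (11/2 * s)"
    by (simp only: mult.assoc)
  hence "e \<le> 11/2 * s" using p34 by (subst (asm) mult_le_cancel_left_pos) auto
  thus ?thesis unfolding w_def[symmetric] e by (rule ennreal_leI)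
qed

lemma gaussian_mean_le_quantile:
  fixes W :: "real^'d \<Rightarrow> ennreal"
  assumes [measurable]: "W \<in> borel_measurable borel" and W: "extended_seminorm W"
    and s: "0 \<le> s" and B: "emeasure std_gaussian {x. W x \<le> ennreal s} \<ge> ennreal (3/4)"
  shows "(\<integral>\<^sup>+x. W x \<partial>std_gaussian) \<le> ennreal (11/2 * s)"
proof -
  have "W x = (SUP n. min (W x) (of_nat n))" for x
  proof -
    have "(SUP n. min (W x) (of_nat n)) = min (W x) (SUP n. of_nat n)"
      by (simp add: min_def inf_SUP flip: inf_min)
    thus ?thesis by (simp add: ennreal_SUP_of_nat_eq_top)
  qed
  hence "(\<integral>\<^sup>+x. W x \<partial>std_gaussian) = (\<integral>\<^sup>+x. (SUP n. min (W x) (of_nat n)) \<partial>std_gaussian)" by simp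
  also have "\<dots> = (SUP n. \<integral>\<^sup>+x. min (W x) (of_nat n) \<partial>std_gaussian)"
  proof (rule nn_integral_monotone_convergence_SUP)
    show "incseq (\<lambda>n x. min (W x) (of_nat n))"
      unfolding incseq_def le_fun_def by (intro allI impI min.mono order_refl of_nat_mono)
  qed measurable
  also have "\<dots> \<le> ennreal (11/2 * s)"
    by (intro SUP_least truncated_gaussian_mean_le_quantile assms)
  finally show ?thesis .
qed

text \<open>The events that \<open>a - A y\<close> and \<open>a + A y\<close> lie in the ball of radius \<open>s\<close> have equal probability,
  larger than \<open>1/2\<close>, so they meet. Averaging the two points shows \<open>V a \<le> s\<close>.\<close>

lemma coverage_centering:
  fixes V :: "real^'d \<Rightarrow> ennreal" and A :: "real^'d^'d"
  assumes [measurable]: "V \<in> borel_measurable borel" and V: "extended_seminorm V"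
    and s: "0 \<le> s" and B: "emeasure std_gaussian {y. V (a - A *v y) \<le> ennreal s} \<ge> ennreal (3/4)"
  shows "emeasure std_gaussian {y. V (A *v y) \<le> ennreal (2 * s)} \<ge> ennreal (3/4)"
proof -
  interpret G: prob_space "std_gaussian :: (real^'d) measure" by (rule prob_space_std_gaussian)
  have tri: "V (x + y) \<le> V x + V y" for x y using V by (auto simp: extended_seminorm_def)
  have scale: "V (c *\<^sub>R x) = ennreal c * V x" if "0 \<le> c" for c x using V that by (auto simp: extended_seminorm_def)
  have neg: "V (- x) = V x" for x using V by (auto simp: extended_seminorm_def)
  let ?B = "{y. V (a - A *v y) \<le> ennreal s}" and ?C = "{y. V (a + A *v y) \<le> ennreal s}"
  have [measurable]: "?B \<in> sets borel" "?C \<in> sets borel" by measurable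
  have "emeasure std_gaussian ?C = (\<integral>\<^sup>+y. indicator ?C y \<partial>std_gaussian)" by simp
  also have "\<dots> = (\<integral>\<^sup>+y. indicator ?C (- y) \<partial>std_gaussian)" by (rule std_gaussian_uminus[symmetric]) measurable
  also have "\<dots> = (\<integral>\<^sup>+y. indicator ?B y \<partial>std_gaussian)"
    by (intro nn_integral_cong) (simp add: indicator_def linear_neg[OF matrix_vector_mul_linear])
  also have "\<dots> = emeasure std_gaussian ?B" by simp
  finally have "G.prob ?C \<ge> 3/4" "G.prob ?B \<ge> 3/4" using B by (simp_all add: G.emeasure_eq_measure)
  moreover have "G.prob ?B + G.prob ?C = G.prob (?B \<union> ?C)" if "?B \<inter> ?C = {}"
    using G.finite_measure_Union[of ?B ?C] that by simp
  moreover have "G.prob (?B \<union> ?C) \<le> 1" by simp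
  ultimately have "?B \<inter> ?C \<noteq> {}" by linarith
  then obtain y where y: "V (a - A *v y) \<le> ennreal s" "V (a + A *v y) \<le> ennreal s" by blast
  have "a = (1/2) *\<^sub>R ((a - A *v y) + (a + A *v y))" by (simp add: scaleR_2[symmetric])
  hence "V a = ennreal (1/2) * V ((a - A *v y) + (a + A *v y))" by (metis scale zero_le_divide_1_iff zero_le_numeral)
  also have "\<dots> \<le> ennreal (1/2) * (V (a - A *v y) + V (a + A *v y))"
    by (intro mult_left_mono tri) simp
  also have "\<dots> \<le> ennreal (1/2) * (ennreal s + ennreal s)"
    by (intro mult_left_mono add_mono y) simp
  also have "\<dots> = ennreal (1/2 * (s + s))"
    using s by (subst ennreal_mult', simp, subst ennreal_plus) auto
  also have "\<dots> = ennreal s" by simp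
  finally have a: "V a \<le> ennreal s" .
  have "?B \<subseteq> {y. V (A *v y) \<le> ennreal (2 * s)}"
  proof safe
    fix y assume yB: "V (a - A *v y) \<le> ennreal s"
    have "V (A *v y) = V (a + - (a - A *v y))" by simp
    also have "\<dots> \<le> V a + V (a - A *v y)" using tri[of a "- (a - A *v y)"] by (simp only: neg)
    also have "\<dots> \<le> ennreal s + ennreal s" using a yB by (rule add_mono)
    finally show "V (A *v y) \<le> ennreal (2 * s)" using s by (simp flip: ennreal_plus)
  qed
  hence "emeasure std_gaussian ?B \<le> emeasure std_gaussian {y. V (A *v y) \<le> ennreal (2 * s)}"
    by (rule emeasure_mono) measurable
  with B show ?thesis by (rule order_trans)
qed

section \<open>The two lower bounds\<close>

text \<open>Coverage under every mean \<open>A h\<close> is transferred to a posterior. The prior precision \<open>N / 4\<close> is a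
  compromise: it inflates the factor \<open>sqrt N\<close> to \<open>sqrt (5 N / 4)\<close>, which the constant in the
  theorem can afford, and it avoids a passage to the limit of a flat prior.\<close>

lemma mean_width_lower_bound:
  fixes \<mu>hat :: "(nat \<Rightarrow> real^'d) \<Rightarrow> real^'d"
  assumes S: "symmetric_set S" and N: "N \<ge> 1" and Sig: "psd_matrix \<Sigma>" and r: "0 \<le> r"
    and m [measurable]: "\<mu>hat \<in> PiM {..<N} (\<lambda>_. borel) \<rightarrow>\<^sub>M borel"
    and cov: "\<And>\<mu>. \<P>(X in gaussian_sample N \<mu> \<Sigma>. sup_norm_on S (\<mu>hat X - \<mu>) \<le> ereal r) \<ge> 3/4"
  shows "gaussian_mean_width ((\<lambda>v. psd_sqrt \<Sigma> *v v) ` S) \<le> ereal (11 * r * sqrt (5/4 * real N))"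
proof -
  define A where "A = psd_sqrt \<Sigma>"
  have symA: "(A *v x) \<bullet> y = x \<bullet> (A *v y)" for x y
    unfolding A_def by (rule psd_matrix_symD[OF psd_matrix_psd_sqrt[OF Sig]])
  define V where "V = dual_seminorm S"
  have Vm [measurable]: "V \<in> borel_measurable borel" by (simp add: V_def)
  have V: "extended_seminorm V" unfolding V_def by (rule extended_seminorm_dual_seminorm[OF S])
  define Q where "Q = {z \<in> space (PiM {..<N} (\<lambda>_. borel) \<Otimes>\<^sub>M borel).
     V (\<mu>hat (linear_sample N A (fst z)) - A *v snd z) \<le> ennreal r}"
  have Qm [measurable]: "Q \<in> sets (PiM {..<N} (\<lambda>_. borel) \<Otimes>\<^sub>M borel)"
    unfolding Q_def by measurable
  define M where "M = sqrt (5/4 * real N)"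
  have M: "M > 0" using N by (simp add: M_def)
  have "\<exists>x b. ennreal (3/4) \<le> emeasure std_gaussian
      {y. (x, (1 / sqrt (real N / 4 + real N)) *\<^sub>R (y + b)) \<in> Q}"
  proof (rule posterior_coverage)
    fix h :: "real^'d"
    interpret H: prob_space "gaussian_sample N (A *v h) \<Sigma>" by (rule prob_space_gaussian_sample)
    let ?E = "{X \<in> space (PiM {..<N} (\<lambda>_. borel)). sup_norm_on S (\<mu>hat X - A *v h) \<le> ereal r}"
    have [measurable]: "?E \<in> sets (PiM {..<N} (\<lambda>_. borel))" by measurable
    have sp: "space (gaussian_sample N (A *v h) \<Sigma>) = space (PiM {..<N} (\<lambda>_. borel))"
      by (rule sets_eq_imp_space_eq) simp
    have "ennreal (3/4) \<le> emeasure (gaussian_sample N (A *v h) \<Sigma>) ?E"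
      using cov[of "A *v h"] by (simp add: H.emeasure_eq_measure sp)
    also have "\<dots> = (\<integral>\<^sup>+X. indicator ?E X \<partial>gaussian_sample N (A *v h) \<Sigma>)" by simp
    also have "\<dots> = (\<integral>\<^sup>+x. ennreal (shift_likelihood N h x) * indicator ?E (linear_sample N A x) \<partial>noise N)"
      unfolding A_def by (rule nn_integral_gaussian_sample) (simp add: A_def[symmetric])
    also have "\<dots> = (\<integral>\<^sup>+x. ennreal (shift_likelihood N h x) * indicator Q (x, h) \<partial>noise N)"
    proof (rule nn_integral_cong)
      fix x assume "x \<in> space (noise N :: (nat \<Rightarrow> real^'d) measure)"
      hence x: "x \<in> space (PiM {..<N} (\<lambda>_. borel))"
        using sets_eq_imp_space_eq[OF sets_noise] by blast
      hence "linear_sample N A x \<in> space (PiM {..<N} (\<lambda>_. borel))"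
        by (rule measurable_space[OF measurable_linear_sample])
      thus "ennreal (shift_likelihood N h x) * indicator ?E (linear_sample N A x)
         = ennreal (shift_likelihood N h x) * indicator Q (x, h)"
        using x by (simp add: indicator_def Q_def V_def dual_seminorm_le_iff[OF r] space_pair_measure)
    qed
    finally show "ennreal (3/4) \<le> (\<integral>\<^sup>+x. ennreal (shift_likelihood N h x) * indicator Q (x, h) \<partial>noise N)" .
  qed (use N in auto)
  moreover have "real N / 4 + real N = 5/4 * real N" by simp
  ultimately obtain x b where xb: "ennreal (3/4) \<le> emeasure std_gaussian {y. (x, (1 / M) *\<^sub>R (y + b)) \<in> Q}"
    unfolding M_def by metis
  define a where "a = M *\<^sub>R \<mu>hat (linear_sample N A x) - A *v b"
  have "{y. (x, (1 / M) *\<^sub>R (y + b)) \<in> Q} \<subseteq> {y. V (a - A *v y) \<le> ennreal (M * r)}"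
  proof safe
    fix y assume "(x, (1 / M) *\<^sub>R (y + b)) \<in> Q"
    hence q: "V (\<mu>hat (linear_sample N A x) - A *v ((1 / M) *\<^sub>R (y + b))) \<le> ennreal r"
      by (simp add: Q_def)
    have "a - A *v y = M *\<^sub>R (\<mu>hat (linear_sample N A x) - A *v ((1 / M) *\<^sub>R (y + b)))"
      using M by (simp add: a_def matrix_vector_mult_scaleR scaleR_diff_right matrix_vector_right_distrib)
    hence "V (a - A *v y) = ennreal M * V (\<mu>hat (linear_sample N A x) - A *v ((1 / M) *\<^sub>R (y + b)))"
      using V M by (simp add: extended_seminorm_def)
    also have "\<dots> \<le> ennreal M * ennreal r" by (intro mult_left_mono q) simp
    finally show "V (a - A *v y) \<le> ennreal (M * r)" using M r by (simp add: ennreal_mult')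
  qed
  hence "emeasure std_gaussian {y. (x, (1 / M) *\<^sub>R (y + b)) \<in> Q}
      \<le> emeasure std_gaussian {y. V (a - A *v y) \<le> ennreal (M * r)}"
    by (rule emeasure_mono) measurable
  with xb have "ennreal (3/4) \<le> emeasure std_gaussian {y. V (a - A *v y) \<le> ennreal (M * r)}"
    by (rule order_trans)
  hence "ennreal (3/4) \<le> emeasure std_gaussian {y. V (A *v y) \<le> ennreal (2 * (M * r))}"
    using M r by (intro coverage_centering[OF Vm V]) auto
  hence "(\<integral>\<^sup>+y. V (A *v y) \<partial>std_gaussian) \<le> ennreal (11/2 * (2 * (M * r)))"
    using M r by (intro gaussian_mean_le_quantile[OF _ extended_seminorm_compose_matrix[OF V]]) auto
  moreover have "gaussian_mean_width ((\<lambda>v. psd_sqrt \<Sigma> *v v) ` S) = enn2ereal (\<integral>\<^sup>+y. V (A *v y) \<partial>std_gaussian)"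
  proof -
    have "(SUP x\<in>(\<lambda>v. A *v v) ` S. ereal (g \<bullet> x)) = sup_norm_on S (A *v g)" for g
      by (simp add: sup_norm_on_def image_image) (metis inner_commute symA)
    thus ?thesis by (simp add: gaussian_mean_width_def A_def[symmetric] e2ennreal_sup_norm_on V_def)
  qed
  ultimately have "gaussian_mean_width ((\<lambda>v. psd_sqrt \<Sigma> *v v) ` S) \<le> enn2ereal (ennreal (11/2 * (2 * (M * r))))"
    by (simp add: less_eq_ennreal.rep_eq)
  also have "\<dots> = ereal (11/2 * (2 * (M * r)))" using M r by (intro enn2ereal_ennreal) auto
  finally show ?thesis by (simp add: M_def mult_ac)
qed

text \<open>If the bound failed, the event \<open>v \<bullet> \<mu>hat > r\<close> would separate the means \<open>0\<close> and \<open>A h\<close>, although the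
  likelihood has second moment only \<open>\<delta> powr (- 1 / 36)\<close>.\<close>

lemma direction_lower_bound:
  fixes \<mu>hat :: "(nat \<Rightarrow> real^'d) \<Rightarrow> real^'d"
  assumes S: "symmetric_set S" and v: "v \<in> S" and N: "N \<ge> 1" and Sig: "psd_matrix \<Sigma>" and r: "0 \<le> r"
    and d: "0 < \<delta>" "\<delta> \<le> 1/4"
    and m [measurable]: "\<mu>hat \<in> PiM {..<N} (\<lambda>_. borel) \<rightarrow>\<^sub>M borel"
    and cov: "\<And>\<mu>. \<P>(X in gaussian_sample N \<mu> \<Sigma>. sup_norm_on S (\<mu>hat X - \<mu>) \<le> ereal r) \<ge> 1 - \<delta>"
  shows "norm (psd_sqrt \<Sigma> *v v) * sqrt (ln (1 / \<delta>) / real N) \<le> 12 * r"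
proof (rule ccontr)
  define A where "A = psd_sqrt \<Sigma>"
  have symA: "(A *v x) \<bullet> y = x \<bullet> (A *v y)" for x y
    unfolding A_def by (rule psd_matrix_symD[OF psd_matrix_psd_sqrt[OF Sig]])
  define w where "w = A *v v"
  define c where "c = sqrt (ln (1 / \<delta>) / real N)"
  assume "\<not> ?thesis"
  hence gt: "12 * r < norm w * c" by (simp add: w_def A_def c_def)
  hence w0: "norm w > 0" using r by (metis linorder_not_le mult_zero_left norm_le_zero_iff norm_zero
        zero_le_mult_iff zero_le_numeral)
  \<comment> \<open>Long enough for \<open>v \<bullet> A h = norm w * c / 6 > 2 r\<close>: then no estimate is within \<open>r\<close> of both means along \<open>v\<close>.\<close>
  define h where "h = (c / 6 / norm w) *\<^sub>R w"
  have wh: "v \<bullet> (A *v h) = norm w * c / 6"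
    using w0 by (simp add: symA[symmetric] w_def[symmetric] h_def dot_square_norm power2_eq_square)
  have L: "ln (1 / \<delta>) \<ge> 0" using d by simp
  have c2: "c\<^sup>2 = ln (1 / \<delta>) / real N" using L by (simp add: c_def)
  have "h \<bullet> h = c\<^sup>2 / 36"
    using w0 by (simp add: h_def dot_square_norm power2_eq_square)
  hence hh: "real N * (h \<bullet> h) = ln (1 / \<delta>) / 36" using N c2 by simp
  define E where "E = {X \<in> space (PiM {..<N} (\<lambda>_. borel)). r < v \<bullet> \<mu>hat X}"
  have Em [measurable]: "E \<in> sets (PiM {..<N} (\<lambda>_. borel))" unfolding E_def by measurable
  have sp: "space (gaussian_sample N \<mu> \<Sigma>) = space (PiM {..<N} (\<lambda>_. borel))" for \<mu>
    by (rule sets_eq_imp_space_eq) simp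
  define F where "F \<mu> = {X \<in> space (PiM {..<N} (\<lambda>_. borel)). sup_norm_on S (\<mu>hat X - \<mu>) \<le> ereal r}" for \<mu>
  have Fm [measurable]: "F \<mu> \<in> sets (PiM {..<N} (\<lambda>_. borel))" for \<mu> unfolding F_def by measurable
  have F: "measure (gaussian_sample N \<mu> \<Sigma>) (F \<mu>) \<ge> 1 - \<delta>" for \<mu>
    using cov[of \<mu>] by (simp add: F_def sp)
  have "F (A *v h) \<subseteq> E"
    using sup_norm_on_abs_le[OF S v] wh gt by (fastforce simp: F_def E_def inner_diff_right)
  hence "measure (gaussian_sample N (A *v h) \<Sigma>) (F (A *v h)) \<le> measure (gaussian_sample N (A *v h) \<Sigma>) E"
    by (intro finite_measure.finite_measure_mono prob_space.finite_measure prob_space_gaussian_sample) auto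
  hence P1: "1 - \<delta> \<le> measure (gaussian_sample N (A *v h) \<Sigma>) E" using F by (rule order_trans[rotated])
  have P0: "measure (gaussian_sample N 0 \<Sigma>) E \<le> \<delta>"
  proof -
    interpret O: prob_space "gaussian_sample N 0 \<Sigma>" by (rule prob_space_gaussian_sample)
    have "E \<inter> F 0 = {}"
      using sup_norm_on_abs_le[OF S v] by (fastforce simp: F_def E_def)
    hence "O.prob E + O.prob (F 0) = O.prob (E \<union> F 0)"
      by (intro O.finite_measure_Union[symmetric]) auto
    also have "\<dots> \<le> 1" by simp
    finally show ?thesis using F[of 0] by simp
  qed
  \<comment> \<open>The fourth root of \<open>\<delta>\<close>. The change of measure is used with \<open>l = 1 / q\<^sup>2\<close>, that is \<open>1 / sqrt \<delta>\<close>.\<close>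
  define q where "q = exp (- ln (1 / \<delta>) / 4)"
  have q4: "q ^ 4 = \<delta>" using d by (simp add: q_def exp_of_nat_mult[symmetric] ln_div)
  have q2: "q\<^sup>2 > 0" by (simp add: q_def)
  have qq: "(q\<^sup>2)\<^sup>2 = \<delta>" using q4 by (simp flip: power_mult)
  have q12: "q\<^sup>2 \<le> 1/2" by (rule power2_le_imp_le) (use qq d in \<open>auto simp: power2_eq_square\<close>)
  have q34: "q \<le> 3/4"
  proof (rule power2_le_imp_le)
    show "q\<^sup>2 \<le> (3/4)\<^sup>2" using q12 by (simp add: power2_eq_square)
  qed simp
  have ex: "q\<^sup>2 * exp (ln (1 / \<delta>) / 36) \<le> q"
  proof -
    have "q\<^sup>2 * exp (ln (1 / \<delta>) / 36) = exp (- ln (1 / \<delta>) / 2 + ln (1 / \<delta>) / 36)"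
      by (simp add: q_def power2_eq_square exp_add[symmetric])
    also have "\<dots> \<le> q" unfolding q_def using L by simp
    finally show ?thesis .
  qed
  have "1 - \<delta> \<le> (1 / q\<^sup>2) / 2 * measure (gaussian_sample N 0 \<Sigma>) E + exp (real N * (h \<bullet> h)) / (2 * (1 / q\<^sup>2))"
    using P1 change_of_measure[OF Em, of "1 / q\<^sup>2" \<Sigma> h] q2 by (simp add: A_def)
  also have "\<dots> \<le> (1 / q\<^sup>2) / 2 * \<delta> + exp (real N * (h \<bullet> h)) / (2 * (1 / q\<^sup>2))"
    using P0 q2 by (intro add_right_mono mult_left_mono) auto
  also have "\<dots> = q\<^sup>2 / 2 + q\<^sup>2 * exp (ln (1 / \<delta>) / 36) / 2"
    unfolding hh using q2 by (simp add: qq[symmetric] power2_eq_square)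
  also have "\<dots> \<le> 1/4 + 3/8" using q12 ex q34 by simp
  finally show False using d by simp
qed

text \<open>Because \<open>2 ^ 7 = 128\<close> is less than \<open>(5/4) ^ 22\<close>.\<close>

lemma log_ratio_factor_le: "1 / 24 * sqrt (ln 2 / ln (5/4)) \<le> 3 / 40"
proof -
  have "7 * ln (2::real) = ln (2 ^ 7)" by (subst ln_realpow) auto
  also have "\<dots> \<le> ln ((5/4) ^ 22)" by (subst ln_le_cancel_iff) (auto simp: power_divide)
  also have "\<dots> = 22 * ln (5/4::real)" by (subst ln_realpow) auto
  finally have "ln 2 / ln (5/4) \<le> (22/7 :: real)" by (simp add: divide_le_eq)
  also have "\<dots> \<le> (9/5)\<^sup>2" by (simp add: power2_eq_square)
  finally have "sqrt (ln 2 / ln (5/4)) \<le> 9/5" by (intro real_le_lsqrt) auto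
  thus ?thesis by simp
qed

theorem theorem3:
  fixes N :: nat
    and \<Sigma> :: "real^'d^'d"
    and S :: "(real^'d) set"
    and \<delta> r :: real
    and \<mu>hat :: "(nat \<Rightarrow> real^'d) \<Rightarrow> real^'d"
  assumes "N \<ge> 1"
    and "psd_matrix \<Sigma>"
    and "symmetric_set S"
    and "span S = UNIV"
    and "0 < \<delta>" and "\<delta> \<le> 1/4"
    and "\<mu>hat \<in> PiM {..<N} (\<lambda>_. borel) \<rightarrow>\<^sub>M borel"
    and "\<And>\<mu>. \<P>(X in gaussian_sample N \<mu> \<Sigma>. sup_norm_on S (\<mu>hat X - \<mu>) \<le> ereal r) \<ge> 1 - \<delta>"
  shows "ereal r \<ge> max
      (ereal (1/24 * sqrt (ln 2 / ln (5/4)))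
        * (gaussian_mean_width ((\<lambda>v. psd_sqrt \<Sigma> *v v) ` S) / ereal (sqrt (real N))))
      ((SUP v\<in>S. ereal (norm (psd_sqrt \<Sigma> *v v))) / 12 * ereal (sqrt (ln (1 / \<delta>) / real N)))"
proof (rule max.boundedI)
  note cov = assms(8)
  have N: "sqrt (real N) > 0" using assms(1) by simp
  have "S \<noteq> {}"
  proof
    assume "S = {}"
    hence "(UNIV :: (real^'d) set) = {0}" using assms(4) by simp
    moreover have "axis undefined 1 \<noteq> (0 :: real^'d)" by simp
    ultimately show False by blast
  qed
  then obtain v0 where v0: "v0 \<in> S" by blast
  have r: "0 \<le> r"
  proof -
    have "\<P>(X in gaussian_sample N 0 \<Sigma>. sup_norm_on S (\<mu>hat X - 0) \<le> ereal r) > 0"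
      using cov[of 0] assms(6) by linarith
    hence "{X \<in> space (gaussian_sample N 0 \<Sigma>). sup_norm_on S (\<mu>hat X - 0) \<le> ereal r} \<noteq> {}"
      by (metis measure_empty less_irrefl)
    then obtain X where "sup_norm_on S (\<mu>hat X - 0) \<le> ereal r" by blast
    from sup_norm_on_abs_le[OF assms(3) v0 this] show ?thesis by linarith
  qed
  have cov34: "\<P>(X in gaussian_sample N \<mu> \<Sigma>. sup_norm_on S (\<mu>hat X - \<mu>) \<le> ereal r) \<ge> 3/4" for \<mu>
    using cov[of \<mu>] assms(6) by linarith
  let ?W = "gaussian_mean_width ((\<lambda>v. psd_sqrt \<Sigma> *v v) ` S)"
  have W: "?W \<le> ereal (11 * r * sqrt (5/4 * real N))"
    by (rule mean_width_lower_bound[OF assms(3,1,2) r assms(7) cov34])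
  have W0: "0 \<le> ?W" by (simp add: gaussian_mean_width_def)
  obtain W' where W': "?W = ereal W'" "0 \<le> W'" "W' \<le> 11 * r * sqrt (5/4 * real N)"
    using W W0 by (cases ?W) auto
  have "sqrt (5/4) \<le> (9/8 :: real)" by (rule real_le_lsqrt) (auto simp: power2_eq_square)
  hence "11 * r * (sqrt (5/4) * sqrt (real N)) \<le> 11 * r * (9/8 * sqrt (real N))"
    using r N by (intro mult_left_mono mult_right_mono) auto
  with W'(3) have "W' \<le> 11 * r * (9/8 * sqrt (real N))"
    unfolding real_sqrt_mult[of "5/4" "real N"] by (rule order_trans)
  hence "W' \<le> 99/8 * r * sqrt (real N)" by simp
  hence "W' / sqrt (real N) \<le> 99/8 * r" using N by (simp add: divide_le_eq)
  hence "1/24 * sqrt (ln 2 / ln (5/4)) * (W' / sqrt (real N)) \<le> 3/40 * (99/8 * r)"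
    using W'(2) N by (intro mult_mono log_ratio_factor_le) auto
  also have "\<dots> \<le> r" using r by simp
  finally show "ereal (1/24 * sqrt (ln 2 / ln (5/4))) * (?W / ereal (sqrt (real N))) \<le> ereal r"
    using N by (simp add: W'(1))
  define c where "c = sqrt (ln (1 / \<delta>) / real N)"
  have c: "c > 0" using assms(1,5,6) by (simp add: c_def)
  have "(SUP v\<in>S. ereal (norm (psd_sqrt \<Sigma> *v v))) \<le> ereal (12 * r / c)"
  proof (rule SUP_least)
    fix v assume "v \<in> S"
    from direction_lower_bound[OF assms(3) this assms(1,2) r assms(5,6,7) cov]
    show "ereal (norm (psd_sqrt \<Sigma> *v v)) \<le> ereal (12 * r / c)"
      using c by (simp add: c_def[symmetric] le_divide_eq)
  qed
  moreover have "0 \<le> (SUP v\<in>S. ereal (norm (psd_sqrt \<Sigma> *v v)))"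
    using v0 by (rule SUP_upper2) simp
  ultimately obtain s where s: "(SUP v\<in>S. ereal (norm (psd_sqrt \<Sigma> *v v))) = ereal s" "s \<le> 12 * r / c"
    by (cases "SUP v\<in>S. ereal (norm (psd_sqrt \<Sigma> *v v))") auto
  have "ereal s / 12 = ereal (s / 12)" by (simp only: numeral_eq_ereal) simp
  thus "(SUP v\<in>S. ereal (norm (psd_sqrt \<Sigma> *v v))) / 12 * ereal (sqrt (ln (1 / \<delta>) / real N)) \<le> ereal r"
    using s(2) c unfolding s(1) c_def[symmetric] by (simp add: le_divide_eq)
qed

end
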